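(* Let $X$ be a complex Banach space, $T\in\mathcal{B}(X)$ and $\alpha>0$. The following assertions are equivalent: (i) $T$ is a $(C,\alpha)$-bounded operator. (ii) There exists a bounded algebra homomorphism $\theta:\tau^{\alpha}(k^{\alpha+1})\to\mathcal{B}(X)$ such that $\theta(e_1)=T$. In the limit case, the following assertions are equivalent: (a) $T$ is power bounded, i.e. $\sup_{n\ge 0}\|T^n\|<\infty$. (b) There exists a bounded algebra homomorphism $\theta:\ell^1\to\mathcal{B}(X)$ such that $\theta(e_1)=T$. (c) For every $0<\alpha<1$ there exists a bounded algebra homomorphism $\theta_\alpha:\tau^{\alpha}(k^{\alpha+1})\to\mathcal{B}(X)$ such that $\theta_\alpha(e_1)=T$, and $\sup_{0<\alpha<1}\|\theta_\alpha\|<\infty$.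
   Context: $\mathbb{N}_0=\{0,1,2,\dots\}$; $\mathcal{B}(X)$ is the Banach algebra of bounded linear operators on $X$. $e_n$ denotes the sequence $e_n(j)=\delta_{n,j}$. $c_{0,0}$ is the space of complex sequences on $\mathbb{N}_0$ with finite support. The product on $c_{0,0}$, $\ell^1$ (sequences on $\mathbb{N}_0$) is convolution $(f*g)(n)=\sum_{j=0}^n f(n-j)g(j)$. For $\alpha>0$, $k^\alpha(n)=\frac{\Gamma(n+\alpha)}{\Gamma(\alpha)\Gamma(n+1)}$, $n\in\mathbb{N}_0$. The Cesàro sum of order $\alpha>0$ of $T$ is $\Delta^{-\alpha}\mathcal{T}(n)=\sum_{j=0}^n k^\alpha(n-j)T^j$, $n\in\mathbb{N}_0$ (with $T^0=I$). $T$ is $(C,\alpha)$-bounded if $\sup_{n}\frac{1}{k^{\alpha+1}(n)}\|\Delta^{-\alpha}\mathcal{T}(n)\|<\infty$. For $f\in c_{0,0}$ and $\beta>0$: $\Delta f(n)=f(n+1)-f(n)$; $W^{-\beta}f(n)=\sum_{j=n}^\infty k^\beta(j-n)f(j)$; and $W^{\beta}f=(-1)^m\Delta^mW^{-(m-\beta)}f$ with $m=[\beta]+1$. The norm $q_\alpha$ on $c_{0,0}$ is $q_\alpha(f)=\sum_{n=0}^\infty k^{\alpha+1}(n)|W^\alpha f(n)|$, and $\tau^\alpha(k^{\alpha+1})$ is the convolution Banach algebra obtained as the completion of $c_{0,0}$ in the norm $q_\alpha$ (the convolution is $q_\alpha$-continuous, up to a multiplicative constant in the submultiplicativity inequality).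 The operator norm $\|\theta_\alpha\|$ is taken with respect to $q_\alpha$. *)

theory Defs
  imports "HOL-Analysis.Analysis"
begin

class complex_banach = banach +
  fixes scaleC :: "complex \<Rightarrow> 'a \<Rightarrow> 'a"
  assumes scaleC_add_right: "scaleC c (x + y) = scaleC c x + scaleC c y"
    and scaleC_add_left: "scaleC (c + d) x = scaleC c x + scaleC d x"
    and scaleC_scaleC: "scaleC c (scaleC d x) = scaleC (c * d) x"
    and scaleC_of_real: "scaleC (of_real r) x = r *\<^sub>R x"
    and norm_scaleC: "norm (scaleC c x) = cmod c * norm x"

instantiation complex :: complex_banach
begin

definition "scaleC c (z::complex) = c * z"

instance
  by standard (auto simp: scaleC_complex_def algebra_simps norm_mult scaleR_conv_of_real)

end

text \<open>The library type of bounded operators only asks for real linearity, so the algebra of bounded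
  operators on a complex Banach space is the following subset of it.\<close>

definition bounded_ops :: "('a::complex_banach \<Rightarrow>\<^sub>L 'a) set" where
  "bounded_ops = {T. \<forall>c x. blinfun_apply T (scaleC c x) = scaleC c (blinfun_apply T x)}"

primrec op_power :: "('a::real_normed_vector \<Rightarrow>\<^sub>L 'a) \<Rightarrow> nat \<Rightarrow> ('a \<Rightarrow>\<^sub>L 'a)" where
  "op_power T 0 = id_blinfun"
| "op_power T (Suc n) = T o\<^sub>L op_power T n"

definition power_bounded :: "('a::real_normed_vector \<Rightarrow>\<^sub>L 'a) \<Rightarrow> bool" where
  "power_bounded T \<longleftrightarrow> bdd_above (range (\<lambda>n. norm (op_power T n)))"

definition cesaro_kernel :: "real \<Rightarrow> nat \<Rightarrow> real" where
  "cesaro_kernel \<alpha> n = Gamma (real n + \<alpha>) / (Gamma \<alpha> * Gamma (real n + 1))"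

definition cesaro_sum :: "real \<Rightarrow> ('a::real_normed_vector \<Rightarrow>\<^sub>L 'a) \<Rightarrow> nat \<Rightarrow> ('a \<Rightarrow>\<^sub>L 'a)" where
  "cesaro_sum \<alpha> T n = (\<Sum>j\<le>n. cesaro_kernel \<alpha> (n - j) *\<^sub>R op_power T j)"

definition cesaro_bounded :: "real \<Rightarrow> ('a::real_normed_vector \<Rightarrow>\<^sub>L 'a) \<Rightarrow> bool" where
  "cesaro_bounded \<alpha> T \<longleftrightarrow>
     bdd_above (range (\<lambda>n. 1 / cesaro_kernel (\<alpha> + 1) n * norm (cesaro_sum \<alpha> T n)))"

record 'e normed_alg =
  alg_carrier :: "'e set"
  alg_add :: "'e \<Rightarrow> 'e \<Rightarrow> 'e"
  alg_scale :: "complex \<Rightarrow> 'e \<Rightarrow> 'e"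
  alg_mult :: "'e \<Rightarrow> 'e \<Rightarrow> 'e"
  alg_norm :: "'e \<Rightarrow> real"

definition alg_dist :: "'e normed_alg \<Rightarrow> 'e \<Rightarrow> 'e \<Rightarrow> real" where
  "alg_dist A f g = alg_norm A (alg_add A f (alg_scale A (- 1) g))"

text \<open>A homomorphism is linear and multiplicative; preservation of a unit is not part of the notion.\<close>

definition bounded_alg_hom :: "'e normed_alg \<Rightarrow> ('e \<Rightarrow> ('a::complex_banach \<Rightarrow>\<^sub>L 'a)) \<Rightarrow> bool" where
  "bounded_alg_hom A \<theta> \<longleftrightarrow>
     (\<forall>f\<in>alg_carrier A. \<theta> f \<in> bounded_ops) \<and>
     (\<forall>f\<in>alg_carrier A. \<forall>g\<in>alg_carrier A. \<theta> (alg_add A f g) = \<theta> f + \<theta> g) \<and>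
     (\<forall>c. \<forall>f\<in>alg_carrier A. \<forall>x.
        blinfun_apply (\<theta> (alg_scale A c f)) x = scaleC c (blinfun_apply (\<theta> f) x)) \<and>
     (\<forall>f\<in>alg_carrier A. \<forall>g\<in>alg_carrier A. \<theta> (alg_mult A f g) = \<theta> f o\<^sub>L \<theta> g) \<and>
     (\<exists>C. \<forall>f\<in>alg_carrier A. norm (\<theta> f) \<le> C * alg_norm A f)"

definition hom_norm :: "'e normed_alg \<Rightarrow> ('e \<Rightarrow> ('a::complex_banach \<Rightarrow>\<^sub>L 'a)) \<Rightarrow> real" where
  "hom_norm A \<theta> = (SUP f\<in>{f \<in> alg_carrier A. alg_norm A f \<le> 1}. norm (\<theta> f))"

definition alg_cauchy :: "'e normed_alg \<Rightarrow> (nat \<Rightarrow> 'e) set" where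
  "alg_cauchy A = {F. (\<forall>n. F n \<in> alg_carrier A) \<and>
     (\<forall>\<epsilon>>0. \<exists>N. \<forall>m\<ge>N. \<forall>n\<ge>N. alg_dist A (F m) (F n) < \<epsilon>)}"

definition cauchy_rel :: "'e normed_alg \<Rightarrow> ((nat \<Rightarrow> 'e) \<times> (nat \<Rightarrow> 'e)) set" where
  "cauchy_rel A = {(F, G). F \<in> alg_cauchy A \<and> G \<in> alg_cauchy A \<and>
     (\<lambda>n. alg_dist A (F n) (G n)) \<longlonglongrightarrow> 0}"

definition cauchy_class :: "'e normed_alg \<Rightarrow> (nat \<Rightarrow> 'e) \<Rightarrow> (nat \<Rightarrow> 'e) set" where
  "cauchy_class A F = cauchy_rel A `` {F}"

definition completion :: "'e normed_alg \<Rightarrow> (nat \<Rightarrow> 'e) set normed_alg" where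
  "completion A = \<lparr>
     alg_carrier = alg_cauchy A // cauchy_rel A,
     alg_add = (\<lambda>x y. \<Union>F\<in>x. \<Union>G\<in>y. cauchy_class A (\<lambda>n. alg_add A (F n) (G n))),
     alg_scale = (\<lambda>c x. \<Union>F\<in>x. cauchy_class A (\<lambda>n. alg_scale A c (F n))),
     alg_mult = (\<lambda>x y. \<Union>F\<in>x. \<Union>G\<in>y. cauchy_class A (\<lambda>n. alg_mult A (F n) (G n))),
     alg_norm = (\<lambda>x. THE r. \<forall>F\<in>x. (\<lambda>n. alg_norm A (F n)) \<longlonglongrightarrow> r) \<rparr>"

definition completion_embed :: "'e normed_alg \<Rightarrow> 'e \<Rightarrow> (nat \<Rightarrow> 'e) set" where
  "completion_embed A f = cauchy_class A (\<lambda>_. f)"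

definition unit_seq :: "nat \<Rightarrow> nat \<Rightarrow> complex" where
  "unit_seq n = (\<lambda>j. if j = n then 1 else 0)"

definition convolution :: "(nat \<Rightarrow> complex) \<Rightarrow> (nat \<Rightarrow> complex) \<Rightarrow> nat \<Rightarrow> complex" where
  "convolution f g = (\<lambda>n. \<Sum>j\<le>n. f (n - j) * g j)"

definition ell1 :: "(nat \<Rightarrow> complex) normed_alg" where
  "ell1 = \<lparr>
     alg_carrier = {f. summable (\<lambda>n. cmod (f n))},
     alg_add = (\<lambda>f g n. f n + g n),
     alg_scale = (\<lambda>c f n. c * f n),
     alg_mult = convolution,
     alg_norm = (\<lambda>f. \<Sum>n. cmod (f n)) \<rparr>"

definition forward_diff :: "(nat \<Rightarrow> complex) \<Rightarrow> nat \<Rightarrow> complex" where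
  "forward_diff f = (\<lambda>n. f (n + 1) - f n)"

definition weyl_sum :: "real \<Rightarrow> (nat \<Rightarrow> complex) \<Rightarrow> nat \<Rightarrow> complex" where
  "weyl_sum \<beta> f = (\<lambda>n. \<Sum>\<^sub>\<infinity>j\<in>{n..}. of_real (cesaro_kernel \<beta> (j - n)) * f j)"

definition weyl_diff :: "real \<Rightarrow> (nat \<Rightarrow> complex) \<Rightarrow> nat \<Rightarrow> complex" where
  "weyl_diff \<beta> f = (let m = nat \<lfloor>\<beta>\<rfloor> + 1 in
     (\<lambda>n. (- 1) ^ m * (forward_diff ^^ m) (weyl_sum (real m - \<beta>) f) n))"

definition q_norm :: "real \<Rightarrow> (nat \<Rightarrow> complex) \<Rightarrow> real" where
  "q_norm \<alpha> f = (\<Sum>n. cesaro_kernel (\<alpha> + 1) n * cmod (weyl_diff \<alpha> f n))"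

definition c00 :: "real \<Rightarrow> (nat \<Rightarrow> complex) normed_alg" where
  "c00 \<alpha> = \<lparr>
     alg_carrier = {f. finite {n. f n \<noteq> 0}},
     alg_add = (\<lambda>f g n. f n + g n),
     alg_scale = (\<lambda>c f n. c * f n),
     alg_mult = convolution,
     alg_norm = q_norm \<alpha> \<rparr>"

definition tau :: "real \<Rightarrow> (nat \<Rightarrow> nat \<Rightarrow> complex) set normed_alg" where
  "tau \<alpha> = completion (c00 \<alpha>)"

definition tau_unit_seq :: "real \<Rightarrow> nat \<Rightarrow> (nat \<Rightarrow> nat \<Rightarrow> complex) set" where
  "tau_unit_seq \<alpha> n = completion_embed (c00 \<alpha>) (unit_seq n)"

end

theory Submission
  imports Defs
begin

text \<open>
  On finitely supported sequences \<open>W\<^sup>\<alpha>\<close> is the Weyl sum of order \<open>-\<alpha>\<close>, and Weyl sums satisfy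
  \<open>W\<^sup>-\<^sup>a W\<^sup>-\<^sup>b = W\<^sup>-\<^sup>(\<^sup>a\<^sup>+\<^sup>b\<^sup>)\<close> by Vandermonde's identity. Hence \<open>f = \<Sum>\<^sub>n W\<^sup>\<alpha>f(n) h\<^sub>n\<close> with
  \<open>h\<^sub>n(j) = k\<^sup>\<alpha>(n - j)\<close> for \<open>j \<le> n\<close>, so that \<open>q\<^sub>\<alpha>\<close> is a weighted \<open>\<ell>\<^sup>1\<close> norm of the
  coefficients with \<open>q\<^sub>\<alpha>(h\<^sub>n) = k\<^sup>\<alpha>\<^sup>+\<^sup>1(n)\<close>. The functional calculus \<open>f \<mapsto> \<Sum>\<^sub>n f(n) T\<^sup>n\<close>
  sends \<open>h\<^sub>n\<close> to the \<open>n\<close>-th Cesaro sum of \<open>T\<close>, which gives the equivalence of (i) and (ii). Continuity of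
  the convolution reduces to bounding \<open>q\<^sub>\<alpha>(h\<^sub>n * h\<^sub>m)\<close>, where \<open>W\<^sup>\<alpha>(h\<^sub>n * h\<^sub>m)\<close> is explicit
  and \<open>k\<^sup>\<alpha>\<^sup>+\<^sup>1\<close> is doubling. For (c) implies (a), let \<open>\<alpha>\<close> tend to 0 in
  \<open>\<parallel>T\<^sup>n\<parallel> \<le> \<parallel>\<theta>\<^sub>\<alpha>\<parallel> q\<^sub>\<alpha>(e\<^sub>n)\<close>, since \<open>q\<^sub>\<alpha>(e\<^sub>n)\<close> tends to 1.
\<close>

section \<open>Complex Banach spaces of operators\<close>

lemma scaleC_zero_right [simp]: "scaleC c (0::'a::complex_banach) = 0"
  using norm_scaleC[of c 0] by simp

lemma scaleC_zero_left [simp]: "scaleC 0 (x::'a::complex_banach) = 0"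
  using norm_scaleC[of 0 x] by simp

lemma scaleC_one [simp]: "scaleC 1 (x::'a::complex_banach) = x"
  using scaleC_of_real[of 1 x] by simp

lemma scaleC_minus_one: "scaleC (-1) (x::'a::complex_banach) = - x"
  using scaleC_of_real[of "-1" x] by simp

lemma bounded_linear_scaleC: "bounded_linear (scaleC c :: 'a::complex_banach \<Rightarrow> 'a)"
proof (rule bounded_linear_intro)
  show "scaleC c (r *\<^sub>R x) = r *\<^sub>R scaleC c x" for r and x :: 'a
    by (simp add: scaleC_scaleC mult.commute flip: scaleC_of_real)
  show "norm (scaleC c x) \<le> norm x * cmod c" for x :: 'a
    by (simp add: norm_scaleC mult.commute)
qed (rule scaleC_add_right)

lemma scaleC_sum_right: "scaleC c (\<Sum>i\<in>I. f i) = (\<Sum>i\<in>I. scaleC c (f i :: 'a::complex_banach))"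
  using linear_sum[OF bounded_linear.linear[OF bounded_linear_scaleC]] .

lemma scaleC_sum_left: "scaleC (\<Sum>i\<in>I. c i) x = (\<Sum>i\<in>I. scaleC (c i) (x :: 'a::complex_banach))"
  by (induction I rule: infinite_finite_induct) (auto simp: scaleC_add_left)

text \<open>Complex scalars act on the values of an operator, which makes sense even for the merely
  real linear members of this type. With this instance, operator series with complex coefficients
  are sums in a complex Banach space.\<close>

instantiation blinfun :: (complex_banach, complex_banach) complex_banach
begin

definition "scaleC c T = Blinfun (\<lambda>x. scaleC c (blinfun_apply T x))"

lemma blinfun_apply_scaleC: "blinfun_apply (scaleC c T) x = scaleC c (blinfun_apply T x)"
  unfolding scaleC_blinfun_def
  by (rule bounded_linear_Blinfun_apply[THEN fun_cong])
    (intro bounded_linear_compose[OF bounded_linear_scaleC] blinfun.bounded_linear_right)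

instance
proof
  fix c d :: complex and r :: real and S T :: "'a \<Rightarrow>\<^sub>L 'b"
  show "scaleC c (S + T) = scaleC c S + scaleC c T" "scaleC (c + d) T = scaleC c T + scaleC d T"
    "scaleC c (scaleC d T) = scaleC (c * d) T" "scaleC (complex_of_real r) T = r *\<^sub>R T"
    by (auto intro!: blinfun_eqI simp: blinfun_apply_scaleC blinfun.add_left blinfun.scaleR_left
        scaleC_add_right scaleC_add_left scaleC_scaleC scaleC_of_real)
  \<comment> \<open>Only this inequality is direct. For nonzero \<open>c\<close> the reverse one
    follows by applying it to \<open>inverse c\<close> and \<open>scaleC c T\<close>.\<close>
  have le: "norm (scaleC c T) \<le> cmod c * norm T" for c and T :: "'a \<Rightarrow>\<^sub>L 'b"
    by (rule norm_blinfun_bound)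
      (auto simp: blinfun_apply_scaleC norm_scaleC mult.assoc intro!: mult_left_mono norm_blinfun)
  show "norm (scaleC c T) = cmod c * norm T"
  proof (cases "c = 0")
    case False
    have "scaleC (inverse c) (scaleC c T) = T"
      using False by (intro blinfun_eqI) (simp add: blinfun_apply_scaleC scaleC_scaleC)
    then have "norm T \<le> inverse (cmod c) * norm (scaleC c T)"
      using le[of "inverse c" "scaleC c T"] by (simp add: norm_inverse)
    then have "cmod c * norm T \<le> norm (scaleC c T)" using False by (simp add: field_simps)
    then show ?thesis using le[of c T] by simp
  qed (use le[of 0 T] in simp)
qed

end

lemma infsum_bounded_linear:
  assumes "bounded_linear h" "f summable_on I"
  shows "infsum (\<lambda>i. h (f i)) I = h (infsum f I)"
  by (rule infsumI[OF has_sum_bounded_linear[OF assms(1) has_sum_infsum[OF assms(2)]]])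

lemma id_bounded_ops: "id_blinfun \<in> bounded_ops"
  by (simp add: bounded_ops_def)

lemma compose_bounded_ops: "S \<in> bounded_ops \<Longrightarrow> T \<in> bounded_ops \<Longrightarrow> S o\<^sub>L T \<in> bounded_ops"
  by (simp add: bounded_ops_def)

lemma scaleC_bounded_ops: "T \<in> bounded_ops \<Longrightarrow> scaleC c T \<in> bounded_ops"
  by (simp add: bounded_ops_def blinfun_apply_scaleC scaleC_scaleC mult.commute)

lemma add_bounded_ops: "S \<in> bounded_ops \<Longrightarrow> T \<in> bounded_ops \<Longrightarrow> S + T \<in> bounded_ops"
  by (simp add: bounded_ops_def blinfun.add_left scaleC_add_right)

text \<open>Complex linearity is a closed condition: evaluation and \<open>scaleC c\<close> are
  continuous, so the two sides of the identity are limits of the same family. This places infinite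
  sums and extended homomorphisms inside \<open>bounded_ops\<close>.\<close>

lemma limit_bounded_ops:
  assumes "F \<noteq> bot" "(g \<longlongrightarrow> T) F" "\<And>n. g n \<in> bounded_ops"
  shows "T \<in> bounded_ops"
  unfolding bounded_ops_def
proof (intro CollectI allI)
  fix c x
  note lim = bounded_linear.tendsto[OF blinfun.bounded_linear_left assms(2)]
  have "((\<lambda>n. scaleC c (blinfun_apply (g n) x)) \<longlongrightarrow> scaleC c (blinfun_apply T x)) F"
    by (rule bounded_linear.tendsto[OF bounded_linear_scaleC lim])
  moreover have "(\<lambda>n. scaleC c (blinfun_apply (g n) x)) = (\<lambda>n. blinfun_apply (g n) (scaleC c x))"
    using assms(3) by (simp add: bounded_ops_def)
  ultimately have "((\<lambda>n. blinfun_apply (g n) (scaleC c x)) \<longlongrightarrow> scaleC c (blinfun_apply T x)) F"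
    by simp
  from tendsto_unique[OF assms(1) lim this]
  show "blinfun_apply T (scaleC c x) = scaleC c (blinfun_apply T x)" .
qed

lemma zero_bounded_ops: "0 \<in> bounded_ops"
  by (simp add: bounded_ops_def)

lemma sum_bounded_ops: "(\<And>i. g i \<in> bounded_ops) \<Longrightarrow> sum g J \<in> bounded_ops"
  by (induction J rule: infinite_finite_induct) (simp_all add: zero_bounded_ops add_bounded_ops)

lemma infsum_bounded_ops:
  assumes "\<And>i. g i \<in> bounded_ops" "g summable_on I"
  shows "infsum g I \<in> bounded_ops"
proof -
  have "(sum g \<longlongrightarrow> infsum g I) (finite_subsets_at_top I)"
    using has_sum_infsum[OF assms(2)] unfolding has_sum_def .
  from limit_bounded_ops[OF finite_subsets_at_top_neq_bot this sum_bounded_ops[OF assms(1)]]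
  show ?thesis .
qed

lemma compose_scaleC_left: "(scaleC c S) o\<^sub>L T = scaleC c (S o\<^sub>L T)"
  by (intro blinfun_eqI) (simp add: blinfun_apply_scaleC)

text \<open>Here complex linearity enters multiplicativity: a scalar leaves the right factor only by
  passing through \<open>S\<close>.\<close>

lemma compose_scaleC_right: "S \<in> bounded_ops \<Longrightarrow> S o\<^sub>L (scaleC c T) = scaleC c (S o\<^sub>L T)"
  by (intro blinfun_eqI) (simp add: blinfun_apply_scaleC bounded_ops_def)

lemma op_power_bounded_ops: "T \<in> bounded_ops \<Longrightarrow> op_power T n \<in> bounded_ops"
  by (induction n) (auto simp: id_bounded_ops compose_bounded_ops)

lemma op_power_add: "op_power T (m + n) = op_power T m o\<^sub>L op_power T n"
  by (induction m) (auto intro!: blinfun_eqI)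

lemma bounded_alg_hom_scale:
  assumes "bounded_alg_hom A \<Phi>" "f \<in> alg_carrier A"
  shows "\<Phi> (alg_scale A c f) = scaleC c (\<Phi> f)"
  using assms by (intro blinfun_eqI) (simp add: bounded_alg_hom_def blinfun_apply_scaleC)

section \<open>The functional calculus f -> sum of f(n) T^n\<close>

definition power_series_op :: "('a::complex_banach \<Rightarrow>\<^sub>L 'a) \<Rightarrow> (nat \<Rightarrow> complex) \<Rightarrow> ('a \<Rightarrow>\<^sub>L 'a)" where
  "power_series_op T f = (\<Sum>\<^sub>\<infinity>n. scaleC (f n) (op_power T n))"

text \<open>This absolute summability holds for finitely supported \<open>f\<close> and every
  \<open>T\<close>, and for absolutely summable \<open>f\<close> when \<open>T\<close> is power
  bounded. Hence one calculus serves both \<open>c00\<close> and \<open>ell1\<close>.\<close>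

abbreviation power_summable :: "('a::complex_banach \<Rightarrow>\<^sub>L 'a) \<Rightarrow> (nat \<Rightarrow> complex) \<Rightarrow> bool" where
  "power_summable T f \<equiv> (\<lambda>n. norm (scaleC (f n) (op_power T n))) summable_on UNIV"

lemma power_series_op_unit_seq: "power_series_op T (unit_seq n) = op_power T n"
proof -
  have "power_series_op T (unit_seq n) = (\<Sum>\<^sub>\<infinity>k\<in>{n}. scaleC (unit_seq n k) (op_power T k))"
    unfolding power_series_op_def by (rule infsum_cong_neutral) (auto simp: unit_seq_def)
  then show ?thesis by (simp add: unit_seq_def)
qed

lemma power_series_op_add:
  assumes "power_summable T f" "power_summable T g"
  shows "power_series_op T (\<lambda>n. f n + g n) = power_series_op T f + power_series_op T g"
  unfolding power_series_op_def scaleC_add_left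
  by (rule infsum_add[OF abs_summable_summable[OF assms(1)] abs_summable_summable[OF assms(2)]])

lemma power_series_op_scale:
  assumes "power_summable T f"
  shows "power_series_op T (\<lambda>n. c * f n) = scaleC c (power_series_op T f)"
  unfolding power_series_op_def scaleC_scaleC[symmetric]
  by (rule infsum_bounded_linear[OF bounded_linear_scaleC abs_summable_summable[OF assms]])

lemma power_series_op_bounded_ops:
  assumes "T \<in> bounded_ops" "power_summable T f"
  shows "power_series_op T f \<in> bounded_ops"
  unfolding power_series_op_def
  by (rule infsum_bounded_ops[OF scaleC_bounded_ops[OF op_power_bounded_ops[OF assms(1)]]
        abs_summable_summable[OF assms(2)]])

text \<open>The Cauchy product: T^i T^j = T^(i+j), and absolute summability over pairs allows the
  double series to be summed by rows or by diagonals.\<close>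

lemma power_series_op_convolution:
  assumes T: "T \<in> bounded_ops" and f: "power_summable T f" and g: "power_summable T g"
  shows "power_series_op T (convolution f g) = power_series_op T f o\<^sub>L power_series_op T g"
proof -
  let ?h = "\<lambda>i j. scaleC (f i * g j) (op_power T (i + j))"
  let ?u = "\<lambda>f n. scaleC (f n) (op_power T n)"
  have h: "?h i j = ?u f i o\<^sub>L ?u g j" for i j
    by (simp add: op_power_add compose_scaleC_left compose_scaleC_right op_power_bounded_ops T scaleC_scaleC)
  have nh: "norm (?h i j) \<le> norm (?u f i) * norm (?u g j)" for i j
    unfolding h by (rule norm_blinfun_compose)
  \<comment> \<open>The products of the two norms are summable over all pairs and dominate
    \<open>?h\<close>, which justifies both applications of Fubini below.\<close>
  have "(\<lambda>p. norm (norm (?u f (fst p)) * norm (?u g (snd p)))) summable_on (UNIV \<times> UNIV)"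
  proof (subst Infinite_Sum.abs_summable_on_Sigma_iff, intro conjI ballI)
    show "(\<lambda>j. norm (norm (?u f (fst (i, j))) * norm (?u g (snd (i, j))))) summable_on UNIV" for i
      using summable_on_cmult_right[OF g] by (simp add: abs_mult)
    show "(\<lambda>i. norm (\<Sum>\<^sub>\<infinity>j. norm (norm (?u f (fst (i, j))) * norm (?u g (snd (i, j)))))) summable_on UNIV"
      using summable_on_cmult_left[OF f]
      by (simp add: abs_mult infsum_cmult_right' infsum_nonneg)
  qed
  then have "(\<lambda>p. norm (case p of (i, j) \<Rightarrow> ?h i j)) summable_on (UNIV \<times> UNIV)"
    by (rule Infinite_Sum.abs_summable_on_comparison_test) (use nh in \<open>auto simp: abs_mult\<close>)
  then have sum: "(\<lambda>(i,j). ?h i j) summable_on (UNIV \<times> UNIV)" by (rule abs_summable_summable)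
  have "power_series_op T f o\<^sub>L power_series_op T g = (\<Sum>\<^sub>\<infinity>i. ?u f i o\<^sub>L power_series_op T g)"
    unfolding power_series_op_def
    by (rule infsum_bounded_linear[symmetric,
        OF bounded_bilinear.bounded_linear_left[OF bounded_bilinear_blinfun_compose] abs_summable_summable[OF f]])
  also have "\<dots> = (\<Sum>\<^sub>\<infinity>i. \<Sum>\<^sub>\<infinity>j. ?h i j)"
    unfolding h power_series_op_def
    by (intro infsum_cong, rule infsum_bounded_linear[symmetric,
        OF bounded_bilinear.bounded_linear_right[OF bounded_bilinear_blinfun_compose] abs_summable_summable[OF g]])
  also have "\<dots> = (\<Sum>\<^sub>\<infinity>(i,j)\<in>UNIV \<times> UNIV. ?h i j)"
    by (rule infsum_Sigma'_banach[OF sum])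
  \<comment> \<open>Pairs are regrouped along the diagonals i + j = n; since j <= n there, the
    subtraction is not truncated and the map is invertible.\<close>
  also have bij: "bij_betw (\<lambda>(n,j). (n - j, j)) (SIGMA n:UNIV. {..n}) (UNIV \<times> (UNIV::nat set))"
    by (rule bij_betwI[where g = "\<lambda>(i,j). (i + j, j)"]) auto
  have "(\<Sum>\<^sub>\<infinity>(i,j)\<in>UNIV \<times> UNIV. ?h i j) = (\<Sum>\<^sub>\<infinity>(n,j)\<in>(SIGMA n:UNIV. {..n}). ?h (n - j) j)"
    using infsum_reindex_bij_betw[OF bij, of "\<lambda>(i,j). ?h i j"] by (simp add: case_prod_unfold)
  also have "\<dots> = (\<Sum>\<^sub>\<infinity>n. \<Sum>\<^sub>\<infinity>j\<in>{..n}. ?h (n - j) j)"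
    using summable_on_reindex_bij_betw[OF bij, of "\<lambda>(i,j). ?h i j"] sum
    by (intro infsum_Sigma'_banach[symmetric]) (simp add: case_prod_unfold)
  also have "\<dots> = (\<Sum>\<^sub>\<infinity>n. ?u (convolution f g) n)"
    by (rule infsum_cong) (auto simp: convolution_def scaleC_sum_left intro!: sum.cong)
  finally show ?thesis by (simp add: power_series_op_def)
qed

section \<open>Cesaro kernels and Weyl sums\<close>

text \<open>The Taylor coefficients of (1 - z)^(-a). Unlike the Gamma quotient, this form is
  meaningful for all real orders, including the orders -a and 0 that describe differences and the
  identity.\<close>

definition kern :: "real \<Rightarrow> nat \<Rightarrow> real" where
  "kern a n = pochhammer a n / fact n"

lemma cesaro_kernel_eq_kern:
  assumes "a > 0" shows "cesaro_kernel a n = kern a n"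
proof -
  have "a \<notin> \<int>\<^sub>\<le>\<^sub>0" using assms by (auto elim!: nonpos_Ints_cases)
  moreover have "Gamma (real n + 1) = fact n"
    by (metis Gamma_fact add.commute)
  ultimately show ?thesis
    unfolding cesaro_kernel_def kern_def by (simp add: pochhammer_Gamma add.commute field_simps)
qed

lemma kern_0_right [simp]: "kern a 0 = 1"
  by (simp add: kern_def)

lemma kern_0_left: "kern 0 n = (if n = 0 then 1 else 0)"
  by (simp add: kern_def pochhammer_0_left)

lemma kern_1_left [simp]: "kern 1 n = 1"
  by (simp add: kern_def flip: pochhammer_fact)

text \<open>The coefficients of 1 - z; they turn a forward difference into a Weyl sum of order -1,
  up to sign.\<close>

lemma kern_neg_1_left: "kern (-1) n = (if n = 0 then 1 else if n = 1 then -1 else 0)"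
proof -
  have "pochhammer (-1::real) n = 0" if "n > 1"
    using that pochhammer_of_nat_eq_0_lemma[of 1 n, where 'a = real] by simp
  then show ?thesis by (auto simp: kern_def)
qed

lemma kern_pos: "a > 0 \<Longrightarrow> kern a n > 0"
  by (simp add: kern_def pochhammer_pos)

lemma kern_nonneg: "a \<ge> 0 \<Longrightarrow> kern a n \<ge> 0"
  by (cases "a = 0") (auto simp: kern_0_left intro: less_imp_le[OF kern_pos])

text \<open>Comparison of coefficients in (1 - z)^(-a) (1 - z)^(-b) = (1 - z)^(-(a+b)), that is,
  Vandermonde's identity for rising factorials.\<close>

lemma kern_add: "(\<Sum>i\<le>n. kern a i * kern b (n - i)) = kern (a + b) n"
proof -
  have "kern (a + b) n = (\<Sum>i\<le>n. of_nat (n choose i) * pochhammer a i * pochhammer b (n - i)) / fact n"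
    by (simp add: kern_def pochhammer_binomial_sum)
  also have "\<dots> = (\<Sum>i\<le>n. kern a i * kern b (n - i))"
    unfolding sum_divide_distrib
    by (intro sum.cong refl) (simp add: kern_def binomial_fact field_simps)
  finally show ?thesis by simp
qed

lemma sum_kern: "(\<Sum>i\<le>n. kern a i) = kern (a + 1) n"
  using kern_add[where b = 1] by simp

lemma kern_mono: "a \<ge> 0 \<Longrightarrow> m \<le> n \<Longrightarrow> kern (a + 1) m \<le> kern (a + 1) n"
  unfolding sum_kern[symmetric] by (rule sum_mono2) (auto simp: kern_nonneg)

text \<open>The step from index N to N + 1 multiplies by 1 + a/(N + 1). For N >= n this is at most
  exp(a/(n + 1)), and k such steps are taken.\<close>

lemma kern_growth:
  assumes "a \<ge> 0"
  shows "kern (a + 1) (n + k) \<le> kern (a + 1) n * exp (a * real k / (real n + 1))"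
proof (induction k)
  case (Suc k)
  have "kern (a + 1) (n + Suc k) = kern (a + 1) (n + k) * (1 + a / (real (n + k) + 1))"
    by (simp add: kern_def pochhammer_Suc field_simps)
  also have "\<dots> \<le> (kern (a + 1) n * exp (a * real k / (real n + 1))) * exp (a / (real n + 1))"
  proof (rule mult_mono[OF Suc.IH])
    have "a / (real (n + k) + 1) \<le> a / (real n + 1)"
      using assms by (intro divide_left_mono) auto
    also have "1 + \<dots> \<le> exp (a / (real n + 1))" by (rule exp_ge_add_one_self)
    finally show "1 + a / (real (n + k) + 1) \<le> exp (a / (real n + 1))" by simp
  qed (use assms in \<open>auto intro!: mult_nonneg_nonneg kern_nonneg\<close>)
  also have "\<dots> = kern (a + 1) n * exp (a * real (Suc k) / (real n + 1))"
    by (simp add: exp_add[symmetric] add_divide_distrib[symmetric] algebra_simps)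
  finally show ?case .
qed simp

text \<open>For m <= n the exponent a m/(n + 1) from \<open>kern_growth\<close> stays below a, so
  the constant does not depend on n and m.\<close>

lemma kern_doubling:
  assumes "a \<ge> 0" "m \<le> n"
  shows "kern (a + 1) (n + m) \<le> exp a * kern (a + 1) n"
proof -
  have "a * real m / (real n + 1) \<le> a"
    using assms by (simp add: field_simps) (smt (verit) mult_left_mono of_nat_mono)
  then have "kern (a + 1) n * exp (a * real m / (real n + 1)) \<le> kern (a + 1) n * exp a"
    using assms by (intro mult_left_mono) (auto intro: kern_nonneg)
  then show ?thesis using kern_growth[OF assms(1), of n m] by (simp add: mult.commute)
qed

section \<open>Weyl sums of arbitrary real order on finitely supported sequences\<close>

lemma finite_support_bound:
  fixes f :: "nat \<Rightarrow> 'a::zero"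
  assumes "finite {n. f n \<noteq> 0}"
  obtains N where "\<And>j. j > N \<Longrightarrow> f j = 0"
  using finite_nat_set_iff_bounded_le[of "{n. f n \<noteq> 0}"] assms by (metis (mono_tags) leD mem_Collect_eq)

lemma finite_support_bound2:
  fixes f g :: "nat \<Rightarrow> 'a::zero"
  assumes "finite {n. f n \<noteq> 0}" "finite {n. g n \<noteq> 0}"
  obtains N where "\<And>j. j > N \<Longrightarrow> f j = 0" "\<And>j. j > N \<Longrightarrow> g j = 0"
proof -
  obtain N M where "\<And>j. j > N \<Longrightarrow> f j = 0" "\<And>j. j > M \<Longrightarrow> g j = 0"
    using finite_support_bound assms by metis
  then show thesis by (intro that[of "max N M"]) auto
qed

lemma finite_support_if_bound:
  fixes f :: "nat \<Rightarrow> 'a::zero"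
  shows "(\<And>j. j > N \<Longrightarrow> f j = 0) \<Longrightarrow> finite {n. f n \<noteq> 0}"
  by (rule finite_subset[of _ "{..N}"]) (auto simp: not_le[symmetric])

text \<open>Sign convention: \<open>weyl a\<close> is W^(-a), so positive orders sum and negative
  orders difference. Treating all orders by one formula makes fractional differences obey the same
  composition law as sums.\<close>

definition weyl :: "real \<Rightarrow> (nat \<Rightarrow> complex) \<Rightarrow> nat \<Rightarrow> complex" where
  "weyl a f n = (\<Sum>i. of_real (kern a i) * f (n + i))"

lemma weyl_eq_sum:
  assumes "\<And>j. j > N \<Longrightarrow> f j = 0"
  shows "weyl a f n = (\<Sum>i\<le>N. of_real (kern a i) * f (n + i))"
  unfolding weyl_def by (rule suminf_finite) (auto simp: assms)

lemma weyl_support: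
  assumes "\<And>j. j > N \<Longrightarrow> f j = 0" and "n > N"
  shows "weyl a f n = 0"
  using assms(2) by (simp add: weyl_eq_sum[OF assms(1)] assms(1))

lemma finite_support_weyl:
  assumes "finite {n. f n \<noteq> 0}"
  shows "finite {n. weyl a f n \<noteq> 0}"
proof -
  obtain N where N: "\<And>j. j > N \<Longrightarrow> f j = 0" using finite_support_bound[OF assms] by blast
  show ?thesis by (rule finite_support_if_bound[of N]) (rule weyl_support[OF N])
qed

lemma weyl_0: "weyl 0 f = f"
proof
  fix n
  have "weyl 0 f n = (\<Sum>i\<in>{0}. of_real (kern 0 i) * f (n + i))"
    unfolding weyl_def by (rule suminf_finite) (auto simp: kern_0_left)
  then show "weyl 0 f n = f n" by simp
qed

lemma forward_diff_eq_weyl: "forward_diff f = (\<lambda>n. - weyl (-1) f n)"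
proof
  fix n
  have "weyl (-1) f n = (\<Sum>i\<in>{0,1}. of_real (kern (-1) i) * f (n + i))"
    unfolding weyl_def by (rule suminf_finite) (auto simp: kern_neg_1_left)
  then show "forward_diff f n = - weyl (-1) f n"
    by (simp add: forward_diff_def kern_neg_1_left)
qed

lemma weyl_scale:
  assumes "finite {n. f n \<noteq> 0}"
  shows "weyl a (\<lambda>n. c * f n) = (\<lambda>n. c * weyl a f n)"
proof -
  obtain N where N: "\<And>j. j > N \<Longrightarrow> f j = 0" using finite_support_bound[OF assms] by blast
  show ?thesis
    by (simp add: fun_eq_iff weyl_eq_sum[of N] N sum_distrib_left mult_ac)
qed

lemma weyl_add:
  assumes "finite {n. f n \<noteq> 0}" "finite {n. g n \<noteq> 0}"
  shows "weyl a (\<lambda>n. f n + g n) = (\<lambda>n. weyl a f n + weyl a g n)"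
proof -
  obtain N where "\<And>j. j > N \<Longrightarrow> f j = 0" "\<And>j. j > N \<Longrightarrow> g j = 0"
    using finite_support_bound2[OF assms] by blast
  then show ?thesis
    by (simp add: fun_eq_iff weyl_eq_sum[of N] sum.distrib algebra_simps)
qed

text \<open>A double sum collected by k = i + j has the coefficient sums of \<open>kern_add\<close>.
  With \<open>weyl_0\<close> this makes \<open>weyl (- a)\<close> the inverse of
  \<open>weyl a\<close>.\<close>

lemma weyl_weyl:
  assumes "finite {n. f n \<noteq> 0}"
  shows "weyl a (weyl b f) = weyl (a + b) f"
proof
  fix n
  obtain N where N: "\<And>j. j > N \<Longrightarrow> f j = 0" using finite_support_bound[OF assms] by blast
  let ?g = "\<lambda>i j. of_real (kern a i * kern b j) * f (n + i + j)"
  have "weyl a (weyl b f) n = (\<Sum>i\<le>N. \<Sum>j\<le>N. ?g i j)"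
    by (simp add: weyl_eq_sum[of N f, OF N] weyl_eq_sum[of N "weyl b f", OF weyl_support[OF N]]
        sum_distrib_left mult_ac)
  \<comment> \<open>Terms with i + j > N read \<open>f\<close> beyond its support, so the square
    shrinks to the triangle needed for summing along diagonals.\<close>
  also have "\<dots> = (\<Sum>i\<le>N. \<Sum>j\<le>N - i. ?g i j)"
    by (intro sum.cong refl sum.mono_neutral_right) (auto simp: N)
  also have "\<dots> = (\<Sum>(i,j)\<in>{(i,j). i + j \<le> N}. ?g i j)"
    by (subst sum.Sigma) (auto intro!: sum.cong)
  also have "\<dots> = (\<Sum>k\<le>N. \<Sum>i\<le>k. ?g i (k - i))"
    by (rule sum.triangle_reindex_eq)
  also have "\<dots> = (\<Sum>k\<le>N. of_real (\<Sum>i\<le>k. kern a i * kern b (k - i)) * f (n + k))"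
    by (intro sum.cong refl) (simp add: sum_distrib_right)
  also have "\<dots> = weyl (a + b) f n"
    by (simp add: kern_add weyl_eq_sum[of N f, OF N])
  finally show "weyl a (weyl b f) n = weyl (a + b) f n" .
qed

lemma weyl_sum_eq_weyl:
  assumes "a > 0" "finite {n. f n \<noteq> 0}"
  shows "weyl_sum a f = weyl a f"
proof
  fix n
  obtain N where N: "\<And>j. j > N \<Longrightarrow> f j = 0" using finite_support_bound[OF assms(2)] by blast
  have "weyl_sum a f n = (\<Sum>\<^sub>\<infinity>j\<in>{n..n+N}. of_real (kern a (j - n)) * f j)"
    unfolding weyl_sum_def cesaro_kernel_eq_kern[OF assms(1)]
    by (rule infsum_cong_neutral) (auto intro!: N)
  also have "\<dots> = (\<Sum>j=n..n+N. of_real (kern a (j - n)) * f j)" by simp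
  also have "\<dots> = (\<Sum>i\<le>N. of_real (kern a i) * f (n + i))"
    by (rule sum.reindex_bij_witness[of _ "\<lambda>i. n + i" "\<lambda>j. j - n"]) auto
  finally show "weyl_sum a f n = weyl a f n" by (simp add: weyl_eq_sum[of N f, OF N])
qed

lemma forward_diff_funpow:
  assumes "finite {n. f n \<noteq> 0}"
  shows "(forward_diff ^^ m) f = (\<lambda>n. (-1) ^ m * weyl (- real m) f n)"
proof (induction m)
  case (Suc m)
  have "(forward_diff ^^ Suc m) f = (\<lambda>n. - weyl (-1) (\<lambda>n. (-1) ^ m * weyl (- real m) f n) n)"
    by (simp add: Suc.IH forward_diff_eq_weyl)
  also have "\<dots> = (\<lambda>n. (-1) ^ Suc m * weyl (-1) (weyl (- real m) f) n)"
    by (simp add: weyl_scale[OF finite_support_weyl[OF assms]])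
  also have "weyl (-1) (weyl (- real m) f) = weyl (- real (Suc m)) f"
    by (simp add: weyl_weyl[OF assms])
  finally show ?case .
qed (simp add: weyl_0)

text \<open>The m-th difference is (-1)^m times the Weyl sum of order -m. The two signs cancel and
  the orders add up to -m + (m - a) = -a, so the auxiliary integer m disappears.\<close>

lemma weyl_diff_eq_weyl:
  assumes "a > 0" "finite {n. f n \<noteq> 0}"
  shows "weyl_diff a f = weyl (- a) f"
proof -
  define m where "m = nat \<lfloor>a\<rfloor> + 1"
  \<comment> \<open>The floor plus one exceeds a even for integer a, so the inner Weyl sum has
    positive order and its Gamma kernel agrees with \<open>kern\<close>.\<close>
  have "real m - a > 0" using assms unfolding m_def by linarith
  then have "weyl_diff a f = (\<lambda>n. (-1) ^ m * ((-1) ^ m * weyl (- real m) (weyl (real m - a) f) n))"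
    using assms(2) unfolding weyl_diff_def Let_def m_def[symmetric]
    by (simp add: weyl_sum_eq_weyl forward_diff_funpow finite_support_weyl)
  also have "\<dots> = weyl (- a) f"
    by (simp add: weyl_weyl[OF assms(2)] fun_eq_iff flip: mult.assoc power_mult_distrib)
  finally show ?thesis .
qed

section \<open>The norm q_a, kernel sequences, and continuity of convolution\<close>

lemma q_norm_eq_sum:
  assumes "a > 0" "\<And>j. j > N \<Longrightarrow> f j = 0"
  shows "q_norm a f = (\<Sum>n\<le>N. kern (a + 1) n * cmod (weyl (- a) f n))"
proof -
  have "weyl_diff a f = weyl (- a) f"
    using assms by (intro weyl_diff_eq_weyl finite_support_if_bound)
  then show ?thesis
    \<comment> \<open>W^a does not enlarge the support bound N, so the defining series stops at
      N.\<close>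
    using assms(1) unfolding q_norm_def
    by (subst suminf_finite[of "{..N}"]) (auto simp: weyl_support[OF assms(2)] cesaro_kernel_eq_kern)
qed

lemma q_norm_scale:
  assumes "a > 0" "finite {n. f n \<noteq> 0}"
  shows "q_norm a (\<lambda>n. c * f n) = cmod c * q_norm a f"
proof -
  obtain N where N: "\<And>j. j > N \<Longrightarrow> f j = 0" using finite_support_bound[OF assms(2)] by blast
  show ?thesis
    by (simp add: q_norm_eq_sum[of a N] assms N weyl_scale norm_mult sum_distrib_left mult_ac)
qed

lemma q_norm_add:
  assumes "a > 0" "finite {n. f n \<noteq> 0}" "finite {n. g n \<noteq> 0}"
  shows "q_norm a (\<lambda>n. f n + g n) \<le> q_norm a f + q_norm a g"
proof -
  obtain N where *: "\<And>j. j > N \<Longrightarrow> f j = 0" "\<And>j. j > N \<Longrightarrow> g j = 0"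
    using finite_support_bound2[OF assms(2,3)] by blast
  have "q_norm a (\<lambda>n. f n + g n) \<le> (\<Sum>n\<le>N. kern (a + 1) n * (cmod (weyl (- a) f n) + cmod (weyl (- a) g n)))"
    using assms
    by (auto simp: q_norm_eq_sum[of a N] * weyl_add intro!: sum_mono mult_left_mono norm_triangle_ineq kern_nonneg)
  also have "\<dots> = q_norm a f + q_norm a g"
    using assms(1) * by (simp add: q_norm_eq_sum[of a N] sum.distrib algebra_simps)
  finally show ?thesis .
qed

lemma q_norm_nonneg:
  assumes "a > 0" "finite {n. f n \<noteq> 0}"
  shows "q_norm a f \<ge> 0"
proof -
  obtain N where N: "\<And>j. j > N \<Longrightarrow> f j = 0" using finite_support_bound[OF assms(2)] by blast
  show ?thesis
    using assms(1) by (auto simp: q_norm_eq_sum[of a N] N intro!: sum_nonneg mult_nonneg_nonneg kern_nonneg)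
qed

lemma finite_support_add:
  fixes f g :: "nat \<Rightarrow> complex"
  shows "finite {n. f n \<noteq> 0} \<Longrightarrow> finite {n. g n \<noteq> 0} \<Longrightarrow> finite {n. f n + g n \<noteq> 0}"
  by (rule finite_subset[of _ "{n. f n \<noteq> 0} \<union> {n. g n \<noteq> 0}"]) auto

lemma finite_support_scale:
  fixes f :: "nat \<Rightarrow> complex"
  shows "finite {n. f n \<noteq> 0} \<Longrightarrow> finite {n. c * f n \<noteq> 0}"
  by (rule finite_subset[of _ "{n. f n \<noteq> 0}"]) auto

lemma finite_support_sum:
  fixes h :: "'i \<Rightarrow> nat \<Rightarrow> complex"
  assumes "finite I" "\<And>i. i \<in> I \<Longrightarrow> finite {n. h i n \<noteq> 0}"
  shows "finite {n. (\<Sum>i\<in>I. c i * h i n) \<noteq> 0}"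
  using assms
proof (induction I rule: finite_induct)
  case (insert i I)
  then show ?case by (simp add: finite_support_add finite_support_scale)
qed simp

lemma q_norm_sum:
  assumes "a > 0" "finite I" "\<And>i. i \<in> I \<Longrightarrow> finite {n. h i n \<noteq> 0}"
  shows "q_norm a (\<lambda>n. \<Sum>i\<in>I. c i * h i n) \<le> (\<Sum>i\<in>I. cmod (c i) * q_norm a (h i))"
  using assms(2,3)
proof (induction I rule: finite_induct)
  case empty
  show ?case using q_norm_scale[OF assms(1), of "\<lambda>_. 0" 0] by simp
next
  case (insert i I)
  then have "q_norm a (\<lambda>n. \<Sum>i\<in>insert i I. c i * h i n)
    \<le> q_norm a (\<lambda>n. c i * h i n) + q_norm a (\<lambda>n. \<Sum>i\<in>I. c i * h i n)"
    using assms(1) by (simp, intro q_norm_add finite_support_scale finite_support_sum) auto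
  then show ?case using insert assms(1) by (simp add: q_norm_scale)
qed

text \<open>The case split matters: beyond n, truncated subtraction would give
  \<open>kern a 0 = 1\<close> instead of 0.\<close>

definition kern_seq :: "real \<Rightarrow> nat \<Rightarrow> nat \<Rightarrow> complex" where
  "kern_seq a n j = (if j \<le> n then of_real (kern a (n - j)) else 0)"

text \<open>At positive order this exhibits h_n as W^(-a) e_n, hence W^a h_n = e_n. At order -a it
  computes W^a e_n, needed for the limit of q_a(e_n).\<close>

lemma weyl_unit_seq: "weyl a (unit_seq n) = kern_seq a n"
proof
  fix j
  have "weyl a (unit_seq n) j = (\<Sum>i\<le>n. of_real (kern a i) * unit_seq n (j + i))"
    by (rule weyl_eq_sum) (simp add: unit_seq_def)
  also have "\<dots> = (\<Sum>i\<in>(if j \<le> n then {n - j} else {}). of_real (kern a i) * unit_seq n (j + i))"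
    by (rule sum.mono_neutral_right) (auto simp: unit_seq_def split: if_splits)
  also have "\<dots> = kern_seq a n j" by (auto simp: kern_seq_def unit_seq_def)
  finally show "weyl a (unit_seq n) j = kern_seq a n j" .
qed

lemma finite_support_kern_seq: "finite {j. kern_seq a n j \<noteq> 0}"
  by (rule finite_support_if_bound[of n]) (simp add: kern_seq_def)

lemma finite_support_unit_seq: "finite {j. unit_seq n j \<noteq> 0}"
  by (rule finite_support_if_bound[of n]) (simp add: unit_seq_def)

text \<open>This is f = W^(-a) (W^a f) written out: the value of W^a f at n appears at position j
  with weight \<open>kern a (n - j)\<close>.\<close>

lemma kern_seq_expansion:
  assumes "\<And>j. j > N \<Longrightarrow> f j = 0"
  shows "f = (\<lambda>j. \<Sum>n\<le>N. weyl (- a) f n * kern_seq a n j)"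
proof
  fix j
  note f = finite_support_if_bound[OF assms]
  have "f j = weyl a (weyl (- a) f) j" by (simp add: weyl_weyl[OF f] weyl_0)
  also have "\<dots> = (\<Sum>i\<le>N. of_real (kern a i) * weyl (- a) f (j + i))"
    by (rule weyl_eq_sum[OF weyl_support[OF assms]])
  also have "\<dots> = (\<Sum>n=j..j+N. of_real (kern a (n - j)) * weyl (- a) f n)"
    by (rule sum.reindex_bij_witness[of _ "\<lambda>n. n - j" "\<lambda>i. j + i"]) auto
  \<comment> \<open>W^a f vanishes beyond N, so the upper limit no longer depends on j.\<close>
  also have "\<dots> = (\<Sum>n=j..N. of_real (kern a (n - j)) * weyl (- a) f n)"
    by (rule sum.mono_neutral_right) (auto intro!: weyl_support[OF assms])
  also have "\<dots> = (\<Sum>n=j..N. weyl (- a) f n * kern_seq a n j)"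
    by (rule sum.cong) (auto simp: kern_seq_def)
  also have "\<dots> = (\<Sum>n\<le>N. weyl (- a) f n * kern_seq a n j)"
    by (rule sum.mono_neutral_left) (auto simp: kern_seq_def)
  finally show "f j = (\<Sum>n\<le>N. weyl (- a) f n * kern_seq a n j)" .
qed

text \<open>At position j the convolution is a sum of \<open>?g l\<close> over max(j, n) <= l <= n +
  min(j, m). Extending the range to n + m gives the first term; by reflection, the surplus is
  exactly the second term. Thus W^a (h_n * h_m) is known explicitly.\<close>

lemma convolution_kern_seq:
  "convolution (kern_seq a n) (kern_seq a m) = weyl a (\<lambda>l. of_real (
     (if n \<le> l \<and> l \<le> n + m then kern a (n + m - l) else 0) -
     (if l < m then kern a (n + m - l) else 0)))"
  (is "_ = weyl a (\<lambda>l. of_real (?w l))")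
proof
  fix j
  let ?g = "\<lambda>l. kern a (l - j) * kern a (n + m - l)"
  have "weyl a (\<lambda>l. of_real (?w l)) j = (\<Sum>i\<le>n+m. of_real (kern a i) * of_real (?w (j + i)))"
    by (rule weyl_eq_sum) auto
  also have "\<dots> = (\<Sum>l=j..j+(n+m). of_real (kern a (l - j)) * of_real (?w l))"
    by (rule sum.reindex_bij_witness[of _ "\<lambda>l. l - j" "\<lambda>i. j + i"]) auto
  also have "\<dots> = of_real (\<Sum>l=j..j+(n+m). (if n \<le> l \<and> l \<le> n + m then ?g l else 0) - (if l < m then ?g l else 0))"
    unfolding of_real_sum by (intro sum.cong refl) (simp add: algebra_simps)
  also have "(\<Sum>l=j..j+(n+m). (if n \<le> l \<and> l \<le> n + m then ?g l else 0) - (if l < m then ?g l else 0))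
    = (\<Sum>l=max j n..n+m. ?g l) - (\<Sum>l=j..<m. ?g l)"
    unfolding sum_subtractf
    by (intro arg_cong2[of _ _ _ _ "(-)"] sum.mono_neutral_cong_right) auto
  also have "\<dots> = (\<Sum>l=max j n..n + min j m. ?g l)"
  proof (cases "j < m")
    case True
    \<comment> \<open>The reflection l -> n + m + j - l swaps the two factors of \<open>?g\<close>
      and carries j, ..., m - 1 to n + j + 1, ..., n + m.\<close>
    have "(\<Sum>l=j..<m. ?g l) = (\<Sum>l=n+j+1..n+m. ?g l)"
      by (rule sum.reindex_bij_witness[of _ "\<lambda>l. n + m + j - l" "\<lambda>l. n + m + j - l"])
        (use True in \<open>auto simp: mult.commute intro!: arg_cong2[of _ _ _ _ "(*)"] arg_cong2[of _ _ _ _ kern]\<close>)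
    moreover have "(\<Sum>l=max j n..n+m. ?g l) = (\<Sum>l=max j n..n+j. ?g l) + (\<Sum>l=n+j+1..n+m. ?g l)"
      using True by (subst sum.union_disjoint[symmetric]) (auto intro!: sum.cong)
    ultimately show ?thesis using True by simp
  qed simp
  \<comment> \<open>With l = n + i the range conditions say precisely that both kernel sequences are
    evaluated inside their supports.\<close>
  also have "\<dots> = (\<Sum>i | i \<le> j \<and> j - i \<le> n \<and> i \<le> m. kern a (n - (j - i)) * kern a (m - i))"
    by (rule sum.reindex_bij_witness[of _ "\<lambda>i. n + i" "\<lambda>l. l - n"])
       (auto intro!: arg_cong2[of _ _ _ _ "(*)"] arg_cong2[of _ _ _ _ kern])
  also have "of_real \<dots> = (\<Sum>i\<le>j. kern_seq a n (j - i) * kern_seq a m i)"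
    unfolding of_real_sum
    by (rule sum.mono_neutral_cong_left) (auto simp: kern_seq_def)
  also have "\<dots> = convolution (kern_seq a n) (kern_seq a m) j"
    by (simp add: convolution_def)
  finally show "convolution (kern_seq a n) (kern_seq a m) j = weyl a (\<lambda>l. of_real (?w l)) j" ..
qed

lemma convolution_commute: "convolution f g = convolution g f"
proof
  fix n
  show "convolution f g n = convolution g f n"
    unfolding convolution_def
    by (rule sum.reindex_bij_witness[of _ "\<lambda>i. n - i" "\<lambda>i. n - i"]) (auto simp: mult.commute)
qed

lemma convolution_support:
  assumes "\<And>j. j > N \<Longrightarrow> f j = 0" "\<And>j. j > M \<Longrightarrow> g j = 0" "j > N + M"
  shows "convolution f g j = 0"
  unfolding convolution_def
proof (rule sum.neutral, rule ballI)
  fix i assume "i \<in> {..j}"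
  then show "f (j - i) * g i = 0" using assms by (cases "i > M") auto
qed

lemma finite_support_convolution:
  assumes "finite {n. f n \<noteq> 0}" "finite {n. g n \<noteq> 0}"
  shows "finite {n. convolution f g n \<noteq> 0}"
proof -
  obtain N M where "\<And>j. j > N \<Longrightarrow> f j = 0" "\<And>j. j > M \<Longrightarrow> g j = 0"
    using finite_support_bound assms by metis
  then show ?thesis by (intro finite_support_if_bound[of "N + M"] convolution_support)
qed

text \<open>Each of the two pieces of W^a (h_n * h_m) contributes at most k^(a+1)(n + m) k^(a+1)(m),
  whence the factor 2. Doubling, available as m <= n, replaces n + m by n at the cost of
  exp(a).\<close>

lemma q_norm_convolution_kern_seq_le:
  assumes a: "a > 0" and "m \<le> n"
  shows "q_norm a (convolution (kern_seq a n) (kern_seq a m))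
    \<le> 2 * exp a * kern (a + 1) n * kern (a + 1) m"
proof -
  define w where "w = (\<lambda>l. (if n \<le> l \<and> l \<le> n + m then kern a (n + m - l) else 0) -
     (if l < m then kern a (n + m - l) else 0))"
  have fw: "finite {l. complex_of_real (w l) \<noteq> 0}"
    using \<open>m \<le> n\<close> by (intro finite_support_if_bound[of "n + m"]) (auto simp: w_def)
  have "weyl (- a) (convolution (kern_seq a n) (kern_seq a m)) = (\<lambda>l. of_real (w l))"
    using weyl_weyl[OF fw, of "- a" a] weyl_0 unfolding convolution_kern_seq w_def by (simp only: add.left_inverse)
  then have "q_norm a (convolution (kern_seq a n) (kern_seq a m)) = (\<Sum>l\<le>n+m. kern (a + 1) l * \<bar>w l\<bar>)"
    using a by (subst q_norm_eq_sum[of a "n + m"]) (auto intro!: convolution_support simp: kern_seq_def)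
  also have "\<dots> \<le> (\<Sum>l\<le>n+m. (if n \<le> l then kern (a + 1) l * kern a (n + m - l) else 0) +
      (if l < m then kern (a + 1) l * kern a (n + m - l) else 0))"
    using a by (intro sum_mono) (auto simp: w_def abs_mult kern_nonneg abs_if)
  also have "\<dots> = (\<Sum>l=n..n+m. kern (a + 1) l * kern a (n + m - l)) +
     (\<Sum>l<m. kern (a + 1) l * kern a (n + m - l))"
    unfolding sum.distrib by (intro arg_cong2[of _ _ _ _ "(+)"] sum.mono_neutral_cong_right) auto
  \<comment> \<open>The weight is largest at n + m, and the remaining kernel values sum to
    k^(a+1)(m).\<close>
  also have "(\<Sum>l=n..n+m. kern (a + 1) l * kern a (n + m - l)) \<le> kern (a + 1) (n + m) * kern (a + 1) m"
  proof -
    have "(\<Sum>l=n..n+m. kern (a + 1) l * kern a (n + m - l)) \<le> (\<Sum>l=n..n+m. kern (a + 1) (n + m) * kern a (n + m - l))"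
      using a by (intro sum_mono mult_right_mono kern_mono) (auto simp: kern_nonneg)
    also have "\<dots> = kern (a + 1) (n + m) * (\<Sum>i\<le>m. kern a i)"
      unfolding sum_distrib_left
      by (rule sum.reindex_bij_witness[of _ "\<lambda>i. n + m - i" "\<lambda>l. n + m - l"]) auto
    finally show ?thesis by (simp add: sum_kern)
  qed
  \<comment> \<open>The roles are exchanged: the weight is at most its value at m, and the kernel
    sum, extended to all l <= n + m, gives k^(a+1)(n + m).\<close>
  also have "(\<Sum>l<m. kern (a + 1) l * kern a (n + m - l)) \<le> kern (a + 1) (n + m) * kern (a + 1) m"
  proof -
    have "(\<Sum>l<m. kern (a + 1) l * kern a (n + m - l)) \<le> (\<Sum>l<m. kern (a + 1) m * kern a (n + m - l))"
      using a by (intro sum_mono mult_right_mono kern_mono) (auto simp: kern_nonneg)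
    also have "\<dots> \<le> (\<Sum>l\<le>n+m. kern (a + 1) m * kern a (n + m - l))"
      using a by (intro sum_mono2) (auto simp: kern_nonneg)
    also have "\<dots> = kern (a + 1) m * (\<Sum>i\<le>n+m. kern a i)"
      unfolding sum_distrib_left
      by (rule sum.reindex_bij_witness[of _ "\<lambda>i. n + m - i" "\<lambda>l. n + m - l"]) auto
    finally show ?thesis by (simp add: sum_kern mult.commute)
  qed
  also have "kern (a + 1) (n + m) * kern (a + 1) m + kern (a + 1) (n + m) * kern (a + 1) m
    = 2 * (kern (a + 1) (n + m) * kern (a + 1) m)" by simp
  also have "\<dots> \<le> 2 * ((exp a * kern (a + 1) n) * kern (a + 1) m)"
    using a assms(2) by (intro mult_left_mono mult_right_mono kern_doubling) (auto simp: kern_nonneg)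
  finally show ?thesis by (simp add: mult_ac)
qed

lemma q_norm_convolution_kern_seq:
  assumes "a > 0"
  shows "q_norm a (convolution (kern_seq a n) (kern_seq a m))
    \<le> 2 * exp a * kern (a + 1) n * kern (a + 1) m"
proof (cases "m \<le> n")
  case False
  then have "q_norm a (convolution (kern_seq a m) (kern_seq a n))
    \<le> 2 * exp a * kern (a + 1) m * kern (a + 1) n"
    by (intro q_norm_convolution_kern_seq_le assms) auto
  then show ?thesis by (simp add: convolution_commute[of "kern_seq a m"] mult_ac)
qed (simp add: q_norm_convolution_kern_seq_le assms)

lemma q_norm_kern_seq:
  assumes "a > 0"
  shows "q_norm a (kern_seq a n) = kern (a + 1) n"
proof -
  have "weyl (- a) (kern_seq a n) = unit_seq n"
    by (simp add: weyl_weyl[OF finite_support_unit_seq] weyl_0 flip: weyl_unit_seq)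
  then show ?thesis
    using assms by (subst q_norm_eq_sum[of a n]) (auto simp: kern_seq_def unit_seq_def if_distrib cong: if_cong)
qed

text \<open>Since q_a is a weighted l^1 norm of the expansion coefficients, bilinearity reduces the
  estimate to pairs of kernel sequences, with the same constant.\<close>

lemma q_norm_convolution:
  assumes a: "a > 0" and "finite {n. f n \<noteq> 0}" "finite {n. g n \<noteq> 0}"
  shows "q_norm a (convolution f g) \<le> 2 * exp a * q_norm a f * q_norm a g"
proof -
  obtain N M where N: "\<And>j. j > N \<Longrightarrow> f j = 0" and M: "\<And>j. j > M \<Longrightarrow> g j = 0"
    using finite_support_bound assms by metis
  let ?F = "weyl (- a) f" and ?G = "weyl (- a) g"
  have "convolution f g = (\<lambda>j. \<Sum>(n,m)\<in>{..N}\<times>{..M}. (?F n * ?G m) * convolution (kern_seq a n) (kern_seq a m) j)"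
  proof
    fix j
    have "convolution f g j = (\<Sum>i\<le>j. (\<Sum>n\<le>N. ?F n * kern_seq a n (j - i)) * (\<Sum>m\<le>M. ?G m * kern_seq a m i))"
      unfolding convolution_def
      using kern_seq_expansion[of N f a, OF N] kern_seq_expansion[of M g a, OF M] by metis
    also have "\<dots> = (\<Sum>i\<le>j. \<Sum>(n,m)\<in>{..N}\<times>{..M}. (?F n * ?G m) * (kern_seq a n (j - i) * kern_seq a m i))"
      unfolding sum_product sum.cartesian_product by (intro sum.cong refl) (auto simp: mult_ac)
    also have "\<dots> = (\<Sum>(n,m)\<in>{..N}\<times>{..M}. \<Sum>i\<le>j. (?F n * ?G m) * (kern_seq a n (j - i) * kern_seq a m i))"
      by (subst sum.swap) (simp add: case_prod_unfold)
    also have "\<dots> = (\<Sum>(n,m)\<in>{..N}\<times>{..M}. (?F n * ?G m) * convolution (kern_seq a n) (kern_seq a m) j)"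
      by (simp add: convolution_def sum_distrib_left)
    finally show "convolution f g j = \<dots>" .
  qed
  then have "q_norm a (convolution f g)
    \<le> (\<Sum>p\<in>{..N}\<times>{..M}. cmod (?F (fst p) * ?G (snd p)) * q_norm a (convolution (kern_seq a (fst p)) (kern_seq a (snd p))))"
    using q_norm_sum[OF a, of "{..N}\<times>{..M}" "\<lambda>p. convolution (kern_seq a (fst p)) (kern_seq a (snd p))"
      "\<lambda>p. ?F (fst p) * ?G (snd p)"]
    by (simp add: finite_support_convolution finite_support_kern_seq case_prod_unfold)
  also have "\<dots> \<le> (\<Sum>p\<in>{..N}\<times>{..M}. cmod (?F (fst p) * ?G (snd p)) * (2 * exp a * kern (a + 1) (fst p) * kern (a + 1) (snd p)))"
    by (intro sum_mono mult_left_mono q_norm_convolution_kern_seq a) auto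
  also have "\<dots> = 2 * exp a * ((\<Sum>n\<le>N. kern (a + 1) n * cmod (?F n)) * (\<Sum>m\<le>M. kern (a + 1) m * cmod (?G m)))"
    unfolding sum_product sum.cartesian_product
    by (subst sum_distrib_left, intro sum.cong refl) (auto simp: norm_mult mult_ac)
  also have "\<dots> = 2 * exp a * q_norm a f * q_norm a g"
    using N M a by (simp add: q_norm_eq_sum[of a N] q_norm_eq_sum[of a M])
  finally show ?thesis .
qed

section \<open>Completions of sequence algebras\<close>

text \<open>Isolates what the completion uses. \<open>K\<close> records that the norm is
  submultiplicative only up to a constant; for \<open>c00 \<alpha>\<close> it is 2
  exp(\<alpha>).\<close>

locale sequence_algebra =
  fixes A :: "(nat \<Rightarrow> complex) normed_alg" and K :: real
  assumes add [simp]: "alg_add A = (\<lambda>f g n. f n + g n)"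
    and scale [simp]: "alg_scale A = (\<lambda>c f n. c * f n)"
    and mult [simp]: "alg_mult A = convolution"
    and add_closed: "f \<in> alg_carrier A \<Longrightarrow> g \<in> alg_carrier A \<Longrightarrow> (\<lambda>n. f n + g n) \<in> alg_carrier A"
    and scale_closed: "f \<in> alg_carrier A \<Longrightarrow> (\<lambda>n. c * f n) \<in> alg_carrier A"
    and mult_closed: "f \<in> alg_carrier A \<Longrightarrow> g \<in> alg_carrier A \<Longrightarrow> convolution f g \<in> alg_carrier A"
    and norm_nonneg: "f \<in> alg_carrier A \<Longrightarrow> alg_norm A f \<ge> 0"
    and norm_add: "f \<in> alg_carrier A \<Longrightarrow> g \<in> alg_carrier A \<Longrightarrow>
      alg_norm A (\<lambda>n. f n + g n) \<le> alg_norm A f + alg_norm A g"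
    and norm_scale: "f \<in> alg_carrier A \<Longrightarrow> alg_norm A (\<lambda>n. c * f n) = cmod c * alg_norm A f"
    and norm_mult: "f \<in> alg_carrier A \<Longrightarrow> g \<in> alg_carrier A \<Longrightarrow>
      alg_norm A (convolution f g) \<le> K * alg_norm A f * alg_norm A g"
    and K_nonneg: "K \<ge> 0"
begin

abbreviation "S \<equiv> alg_carrier A"
abbreviation "q \<equiv> alg_norm A"
abbreviation "d \<equiv> alg_dist A"

lemma dist_eq: "d f g = q (\<lambda>n. f n - g n)"
  by (simp add: alg_dist_def)

lemma diff_closed: "f \<in> S \<Longrightarrow> g \<in> S \<Longrightarrow> (\<lambda>n. f n - g n) \<in> S"
  using add_closed[OF _ scale_closed[of g "-1"], of f] by simp

lemma dist_nonneg: "f \<in> S \<Longrightarrow> g \<in> S \<Longrightarrow> d f g \<ge> 0"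
  unfolding dist_eq by (intro norm_nonneg diff_closed)

lemma dist_self: "f \<in> S \<Longrightarrow> d f f = 0"
  using norm_scale[of f 0] by (simp add: dist_eq)

lemma dist_sym: "f \<in> S \<Longrightarrow> g \<in> S \<Longrightarrow> d f g = d g f"
  using norm_scale[OF diff_closed, of f g "-1"] by (simp add: dist_eq)

lemma dist_triangle: "f \<in> S \<Longrightarrow> g \<in> S \<Longrightarrow> h \<in> S \<Longrightarrow> d f h \<le> d f g + d g h"
  using norm_add[OF diff_closed diff_closed, of f g g h] by (simp add: dist_eq)

lemma dist_norm:
  assumes "f \<in> S" "g \<in> S" shows "\<bar>q f - q g\<bar> \<le> d f g"
proof -
  have "q f \<le> d f g + q g" using norm_add[OF diff_closed, of f g g] assms by (simp add: dist_eq)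
  moreover have "q g \<le> d g f + q f" using norm_add[OF diff_closed, of g f f] assms by (simp add: dist_eq)
  ultimately show ?thesis using dist_sym[OF assms] by linarith
qed

lemma dist_add:
  "f \<in> S \<Longrightarrow> g \<in> S \<Longrightarrow> f' \<in> S \<Longrightarrow> g' \<in> S \<Longrightarrow> d (\<lambda>n. f n + g n) (\<lambda>n. f' n + g' n) \<le> d f f' + d g g'"
  using norm_add[OF diff_closed diff_closed, of f f' g g'] by (simp add: dist_eq algebra_simps)

lemma dist_scale: "f \<in> S \<Longrightarrow> g \<in> S \<Longrightarrow> d (\<lambda>n. c * f n) (\<lambda>n. c * g n) = cmod c * d f g"
  using norm_scale[OF diff_closed, of f g c] by (simp add: dist_eq algebra_simps)

lemma dist_mult:
  assumes "f \<in> S" "g \<in> S" "f' \<in> S" "g' \<in> S"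
  shows "d (convolution f g) (convolution f' g') \<le> K * d f f' * q g + K * q f' * d g g'"
proof -
  \<comment> \<open>The product is changed one factor at a time: fg - f'g' = (f - f')g + f'(g -
    g').\<close>
  have "(\<lambda>n. convolution f g n - convolution f' g' n) =
    (\<lambda>n. convolution (\<lambda>n. f n - f' n) g n + convolution f' (\<lambda>n. g n - g' n) n)"
    by (simp add: convolution_def fun_eq_iff algebra_simps sum_subtractf flip: sum.distrib)
  then have "d (convolution f g) (convolution f' g') =
    q (\<lambda>n. convolution (\<lambda>n. f n - f' n) g n + convolution f' (\<lambda>n. g n - g' n) n)"
    by (simp add: dist_eq)
  also have "\<dots> \<le> q (convolution (\<lambda>n. f n - f' n) g) + q (convolution f' (\<lambda>n. g n - g' n))"
    by (intro norm_add mult_closed diff_closed assms)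
  also have "\<dots> \<le> K * d f f' * q g + K * q f' * d g g'"
    unfolding dist_eq by (intro add_mono norm_mult diff_closed assms)
  finally show ?thesis .
qed

section \<open>Cauchy sequences, their equivalence, and operations on them\<close>

lemma cauchy_carrier: "F \<in> alg_cauchy A \<Longrightarrow> F n \<in> S"
  by (simp add: alg_cauchy_def)

lemma cauchyD: "F \<in> alg_cauchy A \<Longrightarrow> \<epsilon> > 0 \<Longrightarrow> \<exists>N. \<forall>m\<ge>N. \<forall>n\<ge>N. d (F m) (F n) < \<epsilon>"
  by (simp add: alg_cauchy_def)

lemma cauchyI: "(\<And>n. F n \<in> S) \<Longrightarrow> (\<And>\<epsilon>. \<epsilon> > 0 \<Longrightarrow> \<exists>N. \<forall>m\<ge>N. \<forall>n\<ge>N. d (F m) (F n) < \<epsilon>) \<Longrightarrow> F \<in> alg_cauchy A"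
  by (simp add: alg_cauchy_def)

lemma const_cauchy: "f \<in> S \<Longrightarrow> (\<lambda>_. f) \<in> alg_cauchy A"
  by (auto simp: alg_cauchy_def dist_self)

lemma cauchy_norm_convergent:
  assumes F: "F \<in> alg_cauchy A" shows "convergent (\<lambda>n. q (F n))"
proof -
  have "Cauchy (\<lambda>n. q (F n))"
    unfolding Cauchy_def dist_real_def
    using cauchyD[OF F] dist_norm[OF cauchy_carrier[OF F] cauchy_carrier[OF F]] by (meson le_less_trans)
  then show ?thesis by (simp add: Cauchy_convergent)
qed

lemma cauchy_norm_bounded:
  assumes F: "F \<in> alg_cauchy A" obtains B where "B > 0" "\<And>n. q (F n) \<le> B"
proof -
  have "Bseq (\<lambda>n. q (F n))" using cauchy_norm_convergent[OF F] by (rule convergent_imp_Bseq)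
  then obtain B where "B > 0" "\<And>n. norm (q (F n)) \<le> B" unfolding Bseq_def by auto
  then show thesis by (intro that[of B]) (auto simp: abs_le_iff)
qed

lemma relD:
  assumes "(F, G) \<in> cauchy_rel A"
  shows "F \<in> alg_cauchy A" "G \<in> alg_cauchy A" "(\<lambda>n. d (F n) (G n)) \<longlonglongrightarrow> 0"
  using assms by (auto simp: cauchy_rel_def)

lemma relI:
  assumes "F \<in> alg_cauchy A" "G \<in> alg_cauchy A" "\<And>n. d (F n) (G n) \<le> e n" "e \<longlonglongrightarrow> 0"
  shows "(F, G) \<in> cauchy_rel A"
proof -
  have "(\<lambda>n. d (F n) (G n)) \<longlonglongrightarrow> 0"
    by (rule tendsto_sandwich[OF _ _ tendsto_const assms(4)])
      (auto intro!: always_eventually dist_nonneg cauchy_carrier assms)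
  then show ?thesis using assms by (simp add: cauchy_rel_def)
qed

lemma equiv_cauchy_rel: "equiv (alg_cauchy A) (cauchy_rel A)"
proof (rule equivI)
  show "cauchy_rel A \<subseteq> alg_cauchy A \<times> alg_cauchy A" by (auto simp: cauchy_rel_def)
  show "refl_on (alg_cauchy A) (cauchy_rel A)"
    by (auto intro!: refl_onI relI[where e = "\<lambda>_. 0"] simp: dist_self cauchy_carrier)
  show "sym (cauchy_rel A)"
  proof (rule symI)
    fix F G assume "(F, G) \<in> cauchy_rel A"
    note r = relD[OF this]
    show "(G, F) \<in> cauchy_rel A"
      by (rule relI[OF r(2,1) _ r(3)]) (simp add: dist_sym cauchy_carrier r)
  qed
  show "trans (cauchy_rel A)"
  proof (rule transI)
    fix F G H assume "(F, G) \<in> cauchy_rel A" "(G, H) \<in> cauchy_rel A"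
    note r = relD[OF this(1)] and s = relD[OF this(2)]
    show "(F, H) \<in> cauchy_rel A"
    proof (rule relI[OF r(1) s(2)])
      show "d (F n) (H n) \<le> d (F n) (G n) + d (G n) (H n)" for n
        using r s by (intro dist_triangle cauchy_carrier)
      show "(\<lambda>n. d (F n) (G n) + d (G n) (H n)) \<longlonglongrightarrow> 0" using tendsto_add[OF r(3) s(3)] by simp
    qed
  qed
qed

lemma cauchy_add:
  assumes "F \<in> alg_cauchy A" "G \<in> alg_cauchy A"
  shows "(\<lambda>n k. F n k + G n k) \<in> alg_cauchy A"
proof (rule cauchyI)
  show "(\<lambda>k. F n k + G n k) \<in> S" for n by (intro add_closed cauchy_carrier assms)
  fix \<epsilon> :: real assume "\<epsilon> > 0"
  then obtain N M where N: "\<forall>m\<ge>N. \<forall>n\<ge>N. d (F m) (F n) < \<epsilon> / 2" and M: "\<forall>m\<ge>M. \<forall>n\<ge>M. d (G m) (G n) < \<epsilon> / 2"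
    using cauchyD[OF assms(1)] cauchyD[OF assms(2)] half_gt_zero by metis
  have "d (\<lambda>k. F m k + G m k) (\<lambda>k. F n k + G n k) < \<epsilon>" if "m \<ge> max N M" "n \<ge> max N M" for m n
    using dist_add[of "F m" "G m" "F n" "G n"] N[rule_format, of m n] M[rule_format, of m n] that assms
    by (fastforce simp: cauchy_carrier)
  then show "\<exists>N. \<forall>m\<ge>N. \<forall>n\<ge>N. d (\<lambda>k. F m k + G m k) (\<lambda>k. F n k + G n k) < \<epsilon>" by blast
qed

lemma cauchy_scale:
  assumes "F \<in> alg_cauchy A"
  shows "(\<lambda>n k. c * F n k) \<in> alg_cauchy A"
proof (rule cauchyI)
  show "(\<lambda>k. c * F n k) \<in> S" for n by (intro scale_closed cauchy_carrier assms)
  fix \<epsilon> :: real assume "\<epsilon> > 0"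
  \<comment> \<open>Adding 1 keeps the denominator positive when \<open>c\<close> is 0.\<close>
  then have "\<epsilon> / (cmod c + 1) > 0" by (intro divide_pos_pos) (auto intro: add_nonneg_pos)
  then obtain N where N: "\<forall>m\<ge>N. \<forall>n\<ge>N. d (F m) (F n) < \<epsilon> / (cmod c + 1)"
    using cauchyD[OF assms] by blast
  have "d (\<lambda>k. c * F m k) (\<lambda>k. c * F n k) < \<epsilon>" if "m \<ge> N" "n \<ge> N" for m n
  proof -
    have "d (\<lambda>k. c * F m k) (\<lambda>k. c * F n k) = cmod c * d (F m) (F n)"
      by (intro dist_scale cauchy_carrier assms)
    also have "\<dots> \<le> (cmod c + 1) * d (F m) (F n)"
      by (intro mult_right_mono dist_nonneg cauchy_carrier assms) auto
    also have "\<dots> < \<epsilon>" using N that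
      by (metis add.commute add_strict_increasing mult.commute norm_ge_zero pos_less_divide_eq zero_less_one)
    finally show ?thesis .
  qed
  then show "\<exists>N. \<forall>m\<ge>N. \<forall>n\<ge>N. d (\<lambda>k. c * F m k) (\<lambda>k. c * F n k) < \<epsilon>" by blast
qed

lemma dist_mult_bounded:
  assumes "f \<in> S" "g \<in> S" "f' \<in> S" "g' \<in> S" "q g \<le> B" "q f' \<le> B" "B \<ge> 0"
  shows "d (convolution f g) (convolution f' g') \<le> K * B * (d f f' + d g g')"
proof -
  have "K * d f f' * q g \<le> K * d f f' * B" "K * q f' * d g g' \<le> K * B * d g g'"
    using assms K_nonneg
    by (auto intro!: mult_left_mono mult_right_mono mult_nonneg_nonneg dist_nonneg)
  then show ?thesis using dist_mult[OF assms(1-4)] by (simp add: algebra_simps)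
qed

lemma cauchy_mult:
  assumes F: "F \<in> alg_cauchy A" and G: "G \<in> alg_cauchy A"
  shows "(\<lambda>n. convolution (F n) (G n)) \<in> alg_cauchy A"
proof (rule cauchyI)
  show "convolution (F n) (G n) \<in> S" for n by (intro mult_closed cauchy_carrier assms)
  obtain B1 B2 where "B1 > 0" "\<And>n. q (F n) \<le> B1" "B2 > 0" "\<And>n. q (G n) \<le> B2"
    using cauchy_norm_bounded[OF F] cauchy_norm_bounded[OF G] by metis
  then obtain B where B: "B > 0" "\<And>n. q (F n) \<le> B" "\<And>n. q (G n) \<le> B"
    by (meson max.coboundedI1 max.coboundedI2 less_max_iff_disj)
  fix \<epsilon> :: real assume "\<epsilon> > 0"
  \<comment> \<open>The 2 accounts for the two distances; \<open>K + 1\<close> replaces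
    \<open>K\<close>, which may be 0.\<close>
  define \<delta> where "\<delta> = \<epsilon> / (2 * ((K + 1) * B))"
  have "\<delta> > 0" using \<open>\<epsilon> > 0\<close> B(1) K_nonneg by (simp add: \<delta>_def)
  then obtain N M where N: "\<forall>m\<ge>N. \<forall>n\<ge>N. d (F m) (F n) < \<delta>" and M: "\<forall>m\<ge>M. \<forall>n\<ge>M. d (G m) (G n) < \<delta>"
    using cauchyD[OF F] cauchyD[OF G] by metis
  have "d (convolution (F m) (G m)) (convolution (F n) (G n)) < \<epsilon>" if "m \<ge> max N M" "n \<ge> max N M" for m n
  proof -
    have "d (convolution (F m) (G m)) (convolution (F n) (G n)) \<le> K * B * (d (F m) (F n) + d (G m) (G n))"
      using B by (intro dist_mult_bounded cauchy_carrier assms) auto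
    also have "\<dots> \<le> (K + 1) * B * (d (F m) (F n) + d (G m) (G n))"
      using B(1) by (intro mult_right_mono add_nonneg_nonneg dist_nonneg cauchy_carrier assms) auto
    also have "\<dots> < (K + 1) * B * (\<delta> + \<delta>)"
      using N[rule_format, of m n] M[rule_format, of m n] that B(1) K_nonneg
      by (intro mult_strict_left_mono add_strict_mono mult_pos_pos) auto
    also have "\<dots> = \<epsilon>" using B(1) K_nonneg by (simp add: \<delta>_def)
    finally show ?thesis .
  qed
  then show "\<exists>N. \<forall>m\<ge>N. \<forall>n\<ge>N. d (convolution (F m) (G m)) (convolution (F n) (G n)) < \<epsilon>" by blast
qed

section \<open>Operations and norm of the completion\<close>

lemma class_eqI: "(F, G) \<in> cauchy_rel A \<Longrightarrow> cauchy_class A F = cauchy_class A G"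
  unfolding cauchy_class_def by (rule equiv_class_eq[OF equiv_cauchy_rel])

lemma completion_carrier: "alg_carrier (completion A) = cauchy_class A ` alg_cauchy A"
  by (auto simp: completion_def cauchy_class_def quotient_def)

text \<open>The union over all representatives collapses to a single class because equivalent
  arguments yield equivalent sums.\<close>

lemma completion_add:
  assumes "F \<in> alg_cauchy A" "G \<in> alg_cauchy A"
  shows "alg_add (completion A) (cauchy_class A F) (cauchy_class A G) = cauchy_class A (\<lambda>n k. F n k + G n k)"
proof -
  have "congruent2 (cauchy_rel A) (cauchy_rel A) (\<lambda>F G. cauchy_class A (\<lambda>n k. F n k + G n k))"
  proof (rule congruent2I', rule class_eqI)
    fix F F' G G' assume "(F, F') \<in> cauchy_rel A" "(G, G') \<in> cauchy_rel A"
    note r = relD[OF this(1)] relD[OF this(2)]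
    show "(\<lambda>n k. F n k + G n k, \<lambda>n k. F' n k + G' n k) \<in> cauchy_rel A"
    proof (rule relI[OF cauchy_add cauchy_add])
      show "d (\<lambda>k. F n k + G n k) (\<lambda>k. F' n k + G' n k) \<le> d (F n) (F' n) + d (G n) (G' n)" for n
        using r by (intro dist_add cauchy_carrier)
      show "(\<lambda>n. d (F n) (F' n) + d (G n) (G' n)) \<longlonglongrightarrow> 0" using tendsto_add[OF r(3,6)] by simp
    qed (use r in auto)
  qed
  from UN_equiv_class2[OF equiv_cauchy_rel equiv_cauchy_rel this assms]
  show ?thesis by (simp add: completion_def cauchy_class_def)
qed

text \<open>Independence of representatives requires boundedness: a null sequence of distances is
  multiplied by the norms of Cauchy sequences, which share a bound B.\<close>

lemma completion_mult:
  assumes "F \<in> alg_cauchy A" "G \<in> alg_cauchy A"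
  shows "alg_mult (completion A) (cauchy_class A F) (cauchy_class A G) = cauchy_class A (\<lambda>n. convolution (F n) (G n))"
proof -
  have "congruent2 (cauchy_rel A) (cauchy_rel A) (\<lambda>F G. cauchy_class A (\<lambda>n. convolution (F n) (G n)))"
  proof (rule congruent2I', rule class_eqI)
    fix F F' G G' assume "(F, F') \<in> cauchy_rel A" "(G, G') \<in> cauchy_rel A"
    note r = relD[OF this(1)] relD[OF this(2)]
    obtain B1 B2 where "B1 > 0" "\<And>n. q (F' n) \<le> B1" "B2 > 0" "\<And>n. q (G n) \<le> B2"
      using cauchy_norm_bounded r by metis
    then obtain B where B: "B > 0" "\<And>n. q (F' n) \<le> B" "\<And>n. q (G n) \<le> B"
      by (meson max.coboundedI1 max.coboundedI2 less_max_iff_disj)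
    show "(\<lambda>n. convolution (F n) (G n), \<lambda>n. convolution (F' n) (G' n)) \<in> cauchy_rel A"
    proof (rule relI[OF cauchy_mult cauchy_mult])
      show "d (convolution (F n) (G n)) (convolution (F' n) (G' n)) \<le> K * B * (d (F n) (F' n) + d (G n) (G' n))" for n
        using r B by (intro dist_mult_bounded cauchy_carrier) auto
      show "(\<lambda>n. K * B * (d (F n) (F' n) + d (G n) (G' n))) \<longlonglongrightarrow> 0"
        using tendsto_mult_right_zero[OF tendsto_add_zero[OF r(3,6)], of "K * B"] by simp
    qed (use r in auto)
  qed
  from UN_equiv_class2[OF equiv_cauchy_rel equiv_cauchy_rel this assms]
  show ?thesis by (simp add: completion_def cauchy_class_def)
qed

lemma completion_scale:
  assumes "F \<in> alg_cauchy A"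
  shows "alg_scale (completion A) c (cauchy_class A F) = cauchy_class A (\<lambda>n k. c * F n k)"
proof -
  have "congruent (cauchy_rel A) (\<lambda>F. cauchy_class A (\<lambda>n k. c * F n k))"
  proof (rule congruentI, rule class_eqI)
    fix F F' assume "(F, F') \<in> cauchy_rel A"
    note r = relD[OF this(1)]
    show "(\<lambda>n k. c * F n k, \<lambda>n k. c * F' n k) \<in> cauchy_rel A"
    proof (rule relI[OF cauchy_scale cauchy_scale])
      show "d (\<lambda>k. c * F n k) (\<lambda>k. c * F' n k) \<le> cmod c * d (F n) (F' n)" for n
        using r by (simp add: dist_scale cauchy_carrier)
      show "(\<lambda>n. cmod c * d (F n) (F' n)) \<longlonglongrightarrow> 0" using r(3) by (rule tendsto_mult_right_zero)
    qed (use r in auto)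
  qed
  from UN_equiv_class[OF equiv_cauchy_rel this assms]
  show ?thesis by (simp add: completion_def cauchy_class_def)
qed

text \<open>The definite description picks a genuine limit: norms converge along a Cauchy sequence,
  and equivalent sequences have norms differing by a null sequence.\<close>

lemma completion_norm_tendsto:
  assumes F: "F \<in> alg_cauchy A"
  shows "(\<lambda>n. q (F n)) \<longlonglongrightarrow> alg_norm (completion A) (cauchy_class A F)"
proof -
  obtain r where r: "(\<lambda>n. q (F n)) \<longlonglongrightarrow> r"
    using cauchy_norm_convergent[OF F] by (auto simp: convergent_def)
  have *: "(\<lambda>n. q (G n)) \<longlonglongrightarrow> r" if "G \<in> cauchy_class A F" for G
  proof -
    have "(F, G) \<in> cauchy_rel A" using that by (simp add: cauchy_class_def)
    note s = relD[OF this]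
    have "(\<lambda>n. q (G n) - q (F n)) \<longlonglongrightarrow> 0"
    proof (rule Lim_null_comparison[OF always_eventually s(3)], intro allI)
      show "norm (q (G n) - q (F n)) \<le> d (F n) (G n)" for n
        using dist_norm[of "F n" "G n"] s by (simp add: cauchy_carrier abs_minus_commute)
    qed
    from tendsto_add[OF this r] show ?thesis by simp
  qed
  have "F \<in> cauchy_class A F"
    unfolding cauchy_class_def using F equiv_class_self[OF equiv_cauchy_rel] by blast
  then have "(THE r. \<forall>G\<in>cauchy_class A F. (\<lambda>n. q (G n)) \<longlonglongrightarrow> r) = r"
    using * by (intro the_equality) (auto intro: LIMSEQ_unique)
  then show ?thesis using r by (simp add: completion_def)
qed

section \<open>The canonical embedding; restriction and extension of homomorphisms\<close>

lemma completion_norm_embed: "f \<in> S \<Longrightarrow> alg_norm (completion A) (completion_embed A f) = q f"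
  using LIMSEQ_unique[OF completion_norm_tendsto[OF const_cauchy] tendsto_const]
  by (simp add: completion_embed_def)

lemma embed_closed: "f \<in> S \<Longrightarrow> completion_embed A f \<in> alg_carrier (completion A)"
  by (simp add: completion_carrier completion_embed_def const_cauchy)

text \<open>Constant sequences embed the algebra compatibly with its operations and norm, so
  composition with the embedding preserves every clause of the notion.\<close>

lemma bounded_alg_hom_restrict:
  assumes "bounded_alg_hom (completion A) \<theta>"
  shows "bounded_alg_hom A (\<lambda>f. \<theta> (completion_embed A f))"
proof -
  note const_cauchy [simp] embed_closed [simp]
  have *: "completion_embed A (\<lambda>n. f n + g n) = alg_add (completion A) (completion_embed A f) (completion_embed A g)"
     "completion_embed A (convolution f g) = alg_mult (completion A) (completion_embed A f) (completion_embed A g)"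
     "completion_embed A (\<lambda>n. c * f n) = alg_scale (completion A) c (completion_embed A f)"
    if "f \<in> S" "g \<in> S" for f g c
    using that by (simp_all add: completion_embed_def completion_add completion_mult completion_scale)
  obtain C where "\<forall>x\<in>alg_carrier (completion A). norm (\<theta> x) \<le> C * alg_norm (completion A) x"
    using assms by (auto simp: bounded_alg_hom_def)
  then have "\<forall>f\<in>S. norm (\<theta> (completion_embed A f)) \<le> C * q f"
    by (metis completion_norm_embed embed_closed)
  then show ?thesis
    using assms unfolding bounded_alg_hom_def by (auto simp: *)
qed

text \<open>A bounded linear map is Lipschitz and so extends by limits; algebraic identities pass to
  the limit. The constant \<open>C\<close> is preserved, which later gives a bound uniform in
  \<alpha>.\<close>

lemma bounded_alg_hom_extend:
  fixes \<Phi> :: "(nat \<Rightarrow> complex) \<Rightarrow> ('a::complex_banach \<Rightarrow>\<^sub>L 'a)"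
  assumes \<Phi>: "bounded_alg_hom A \<Phi>" and C: "\<And>f. f \<in> S \<Longrightarrow> norm (\<Phi> f) \<le> C * q f"
  obtains \<theta> where "bounded_alg_hom (completion A) \<theta>"
    "\<And>f. f \<in> S \<Longrightarrow> \<theta> (completion_embed A f) = \<Phi> f"
    "\<And>x. x \<in> alg_carrier (completion A) \<Longrightarrow> norm (\<theta> x) \<le> C * alg_norm (completion A) x"
proof -
  have ops: "\<Phi> f \<in> bounded_ops" and scale: "\<Phi> (\<lambda>n. c * f n) = scaleC c (\<Phi> f)"
    if "f \<in> S" for f c
    using that \<Phi> bounded_alg_hom_scale[OF \<Phi>, of f c] by (auto simp: bounded_alg_hom_def)
  have add: "\<Phi> (\<lambda>n. f n + g n) = \<Phi> f + \<Phi> g" and mult: "\<Phi> (convolution f g) = \<Phi> f o\<^sub>L \<Phi> g"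
    if "f \<in> S" "g \<in> S" for f g
    using that \<Phi> by (auto simp: bounded_alg_hom_def)
  \<comment> \<open>\<open>C\<close> could be negative, so its absolute value serves as Lipschitz
    constant.\<close>
  have diff: "norm (\<Phi> f - \<Phi> g) \<le> \<bar>C\<bar> * d f g" if "f \<in> S" "g \<in> S" for f g
  proof -
    have "\<Phi> (\<lambda>n. f n - g n) = \<Phi> f - \<Phi> g"
      using add[OF that(1) scale_closed[OF that(2)], of "-1"] scale[OF that(2), of "-1"]
      by (simp add: scaleC_minus_one)
    then have "norm (\<Phi> f - \<Phi> g) \<le> C * d f g" using C[OF diff_closed[OF that]] by (simp add: dist_eq)
    also have "\<dots> \<le> \<bar>C\<bar> * d f g" by (intro mult_right_mono dist_nonneg that) auto
    finally show ?thesis .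
  qed
  have conv: "convergent (\<lambda>n. \<Phi> (F n))" if F: "F \<in> alg_cauchy A" for F
  proof -
    have "Cauchy (\<lambda>n. \<Phi> (F n))"
    proof (rule CauchyI)
      fix e :: real assume "e > 0"
      then have "e / (\<bar>C\<bar> + 1) > 0" by (intro divide_pos_pos) auto
      then obtain N where N: "\<forall>m\<ge>N. \<forall>n\<ge>N. d (F m) (F n) < e / (\<bar>C\<bar> + 1)"
        using cauchyD[OF F] by blast
      have "norm (\<Phi> (F m) - \<Phi> (F n)) < e" if "m \<ge> N" "n \<ge> N" for m n
      proof -
        have "norm (\<Phi> (F m) - \<Phi> (F n)) \<le> \<bar>C\<bar> * d (F m) (F n)"
          by (intro diff cauchy_carrier F)
        also have "\<dots> \<le> (\<bar>C\<bar> + 1) * d (F m) (F n)"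
          by (intro mult_right_mono dist_nonneg cauchy_carrier F) auto
        also have "\<dots> < e" using N[rule_format, OF that]
          by (subst mult.commute) (simp add: pos_less_divide_eq)
        finally show ?thesis .
      qed
      then show "\<exists>N. \<forall>m\<ge>N. \<forall>n\<ge>N. norm (\<Phi> (F m) - \<Phi> (F n)) < e" by blast
    qed
    then show ?thesis by (rule Cauchy_convergent)
  qed
  \<comment> \<open>The limit is taken along one chosen representative; the next fact shows that
    every representative gives the same limit.\<close>
  define \<theta> where "\<theta> x = lim (\<lambda>n. \<Phi> ((SOME F. F \<in> x) n))" for x
  have \<theta>: "(\<lambda>n. \<Phi> (F n)) \<longlonglongrightarrow> \<theta> (cauchy_class A F)" if F: "F \<in> alg_cauchy A" for F
  proof -
    define G where "G = (SOME G. G \<in> cauchy_class A F)"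
    have "F \<in> cauchy_class A F"
      unfolding cauchy_class_def using F equiv_class_self[OF equiv_cauchy_rel] by blast
    then have "G \<in> cauchy_class A F" unfolding G_def by (rule someI[of "\<lambda>G. G \<in> cauchy_class A F"])
    then have "(F, G) \<in> cauchy_rel A" by (simp add: cauchy_class_def)
    note r = relD[OF this]
    have lim: "(\<lambda>n. \<Phi> (G n)) \<longlonglongrightarrow> \<theta> (cauchy_class A F)"
      using conv[OF r(2)] by (simp add: \<theta>_def G_def[symmetric] convergent_LIMSEQ_iff)
    have "(\<lambda>n. \<Phi> (F n) - \<Phi> (G n)) \<longlonglongrightarrow> 0"
      by (rule Lim_null_comparison[OF _ tendsto_mult_right_zero[OF r(3), of "\<bar>C\<bar>"]])
        (auto intro!: always_eventually diff cauchy_carrier r)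
    from tendsto_add[OF this lim] show ?thesis by simp
  qed
  have bound: "norm (\<theta> x) \<le> C * alg_norm (completion A) x" if "x \<in> alg_carrier (completion A)" for x
  proof -
    obtain F where F: "F \<in> alg_cauchy A" and x: "x = cauchy_class A F"
      using \<open>x \<in> _\<close> by (auto simp: completion_carrier)
    show ?thesis unfolding x
      by (rule LIMSEQ_le[OF tendsto_norm[OF \<theta>[OF F]] tendsto_mult_left[OF completion_norm_tendsto[OF F]]])
        (auto intro!: C cauchy_carrier F)
  qed
  have "bounded_alg_hom (completion A) \<theta>"
    unfolding bounded_alg_hom_def completion_carrier Ball_image_comp comp_def
  proof (intro conjI ballI allI)
    fix F assume F: "F \<in> alg_cauchy A"
    show "\<theta> (cauchy_class A F) \<in> bounded_ops"
      by (rule limit_bounded_ops[OF _ \<theta>[OF F]]) (auto intro!: ops cauchy_carrier F)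
    fix G assume G: "G \<in> alg_cauchy A"
    note FG = cauchy_carrier[OF F] cauchy_carrier[OF G]
    have "(\<lambda>n. \<Phi> (F n) + \<Phi> (G n)) \<longlonglongrightarrow> \<theta> (cauchy_class A (\<lambda>n k. F n k + G n k))"
      using \<theta>[OF cauchy_add[OF F G]] by (simp add: add FG)
    then show "\<theta> (alg_add (completion A) (cauchy_class A F) (cauchy_class A G)) =
        \<theta> (cauchy_class A F) + \<theta> (cauchy_class A G)"
      unfolding completion_add[OF F G]
      by (rule LIMSEQ_unique[OF _ tendsto_add[OF \<theta>[OF F] \<theta>[OF G]]])
    have "(\<lambda>n. \<Phi> (F n) o\<^sub>L \<Phi> (G n)) \<longlonglongrightarrow> \<theta> (cauchy_class A (\<lambda>n. convolution (F n) (G n)))"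
      using \<theta>[OF cauchy_mult[OF F G]] by (simp add: mult FG)
    then show "\<theta> (alg_mult (completion A) (cauchy_class A F) (cauchy_class A G)) =
        \<theta> (cauchy_class A F) o\<^sub>L \<theta> (cauchy_class A G)"
      unfolding completion_mult[OF F G]
      by (rule LIMSEQ_unique[OF _
        bounded_bilinear.tendsto[OF bounded_bilinear_blinfun_compose \<theta>[OF F] \<theta>[OF G]]])
  next
    fix c F x assume F: "F \<in> alg_cauchy A"
    have "(\<lambda>n. scaleC c (\<Phi> (F n))) \<longlonglongrightarrow> \<theta> (cauchy_class A (\<lambda>n k. c * F n k))"
      using \<theta>[OF cauchy_scale[OF F], of c] by (simp add: scale cauchy_carrier[OF F])
    then have "\<theta> (alg_scale (completion A) c (cauchy_class A F)) = scaleC c (\<theta> (cauchy_class A F))"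
      unfolding completion_scale[OF F]
      by (rule LIMSEQ_unique[OF _ bounded_linear.tendsto[OF bounded_linear_scaleC \<theta>[OF F]]])
    then show "blinfun_apply (\<theta> (alg_scale (completion A) c (cauchy_class A F))) x =
        scaleC c (blinfun_apply (\<theta> (cauchy_class A F)) x)"
      by (simp add: blinfun_apply_scaleC)
  next
    show "\<exists>C. \<forall>F\<in>alg_cauchy A. norm (\<theta> (cauchy_class A F)) \<le> C * alg_norm (completion A) (cauchy_class A F)"
      using bound by (auto simp: completion_carrier)
  qed
  moreover have "\<theta> (completion_embed A f) = \<Phi> f" if "f \<in> S" for f
    using LIMSEQ_unique[OF \<theta>[OF const_cauchy[OF that]] tendsto_const] by (simp add: completion_embed_def)
  ultimately show thesis using bound by (intro that)
qed

end

section \<open>Homomorphisms and Cesaro boundedness\<close>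

lemma c00_simps [simp]:
  "alg_carrier (c00 \<alpha>) = {f. finite {n. f n \<noteq> 0}}" "alg_add (c00 \<alpha>) = (\<lambda>f g n. f n + g n)"
  "alg_scale (c00 \<alpha>) = (\<lambda>c f n. c * f n)" "alg_mult (c00 \<alpha>) = convolution"
  "alg_norm (c00 \<alpha>) = q_norm \<alpha>"
  by (simp_all add: c00_def)

lemma ell1_simps [simp]:
  "alg_carrier ell1 = {f. summable (\<lambda>n. cmod (f n))}" "alg_add ell1 = (\<lambda>f g n. f n + g n)"
  "alg_scale ell1 = (\<lambda>c f n. c * f n)" "alg_mult ell1 = convolution"
  "alg_norm ell1 = (\<lambda>f. \<Sum>n. cmod (f n))"
  by (simp_all add: ell1_def)

lemma sequence_algebra_c00: "\<alpha> > 0 \<Longrightarrow> sequence_algebra (c00 \<alpha>) (2 * exp \<alpha>)"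
  by standard
    (simp_all add: finite_support_add finite_support_scale finite_support_convolution
      q_norm_nonneg q_norm_add q_norm_scale q_norm_convolution)

lemma compose_id_blinfun_right [simp]: "T o\<^sub>L id_blinfun = T"
  by (rule blinfun_eqI) simp

lemma power_summable_finite_support:
  assumes "finite {n. f n \<noteq> 0}" shows "power_summable T f"
  by (rule finite_nonzero_values_imp_summable_on, rule finite_subset[OF _ assms])
    (auto simp: norm_scaleC)

lemma power_series_op_eq_sum:
  assumes "\<And>j. j > N \<Longrightarrow> f j = 0"
  shows "power_series_op T f = (\<Sum>n\<le>N. scaleC (f n) (op_power T n))"
proof -
  have "power_series_op T f = (\<Sum>\<^sub>\<infinity>n\<in>{..N}. scaleC (f n) (op_power T n))"
    unfolding power_series_op_def by (rule infsum_cong_neutral) (auto simp: assms)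
  then show ?thesis by simp
qed

lemma sum_kern_seq_op_power:
  assumes "\<alpha> > 0" "n \<le> N"
  shows "(\<Sum>j\<le>N. scaleC (kern_seq \<alpha> n j) (op_power T j)) = cesaro_sum \<alpha> T n"
proof -
  have "(\<Sum>j\<le>N. scaleC (kern_seq \<alpha> n j) (op_power T j)) = (\<Sum>j\<le>n. scaleC (kern_seq \<alpha> n j) (op_power T j))"
    using assms(2) by (intro sum.mono_neutral_right) (auto simp: kern_seq_def)
  then show ?thesis
    using assms(1) by (simp add: cesaro_sum_def kern_seq_def cesaro_kernel_eq_kern scaleC_of_real)
qed

text \<open>Inserting the expansion of \<open>f\<close> in kernel sequences and exchanging two
  finite sums regroups the powers of \<open>T\<close> into Cesaro sums.\<close>

lemma power_series_op_eq_cesaro: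
  assumes "\<alpha> > 0" "\<And>j. j > N \<Longrightarrow> f j = 0"
  shows "power_series_op T f = (\<Sum>n\<le>N. scaleC (weyl (- \<alpha>) f n) (cesaro_sum \<alpha> T n))"
proof -
  have "power_series_op T f = (\<Sum>j\<le>N. scaleC (\<Sum>n\<le>N. weyl (- \<alpha>) f n * kern_seq \<alpha> n j) (op_power T j))"
    by (subst power_series_op_eq_sum[where N = N], rule assms(2), assumption)
      (intro sum.cong refl arg_cong2[of _ _ _ _ scaleC] fun_cong[OF kern_seq_expansion] assms(2))
  also have "\<dots> = (\<Sum>n\<le>N. \<Sum>j\<le>N. scaleC (weyl (- \<alpha>) f n) (scaleC (kern_seq \<alpha> n j) (op_power T j)))"
    unfolding scaleC_sum_left scaleC_scaleC by (rule sum.swap)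
  also have "\<dots> = (\<Sum>n\<le>N. scaleC (weyl (- \<alpha>) f n) (cesaro_sum \<alpha> T n))"
    by (simp add: scaleC_sum_right[symmetric] sum_kern_seq_op_power assms(1))
  finally show ?thesis .
qed

text \<open>The growth allowed for the Cesaro sums is exactly the weight in \<open>q_norm\<close>,
  so the triangle inequality suffices.\<close>

lemma norm_power_series_op_le:
  assumes "\<alpha> > 0" "finite {n. f n \<noteq> 0}" "\<And>n. norm (cesaro_sum \<alpha> T n) \<le> C * kern (\<alpha> + 1) n"
  shows "norm (power_series_op T f) \<le> C * q_norm \<alpha> f"
proof -
  obtain N where N: "\<And>j. j > N \<Longrightarrow> f j = 0" using finite_support_bound[OF assms(2)] by blast
  have "norm (power_series_op T f) = norm (\<Sum>n\<le>N. scaleC (weyl (- \<alpha>) f n) (cesaro_sum \<alpha> T n))"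
    by (rule arg_cong[OF power_series_op_eq_cesaro[OF assms(1) N]])
  also have "\<dots> \<le> (\<Sum>n\<le>N. norm (scaleC (weyl (- \<alpha>) f n) (cesaro_sum \<alpha> T n)))"
    by (rule norm_sum)
  also have "\<dots> = (\<Sum>n\<le>N. cmod (weyl (- \<alpha>) f n) * norm (cesaro_sum \<alpha> T n))"
    by (simp add: norm_scaleC)
  also have "\<dots> \<le> (\<Sum>n\<le>N. cmod (weyl (- \<alpha>) f n) * (C * kern (\<alpha> + 1) n))"
    by (intro sum_mono mult_left_mono assms) auto
  also have "\<dots> = C * q_norm \<alpha> f"
    using q_norm_eq_sum[of \<alpha> N f, OF assms(1) N] by (simp add: sum_distrib_left mult_ac)
  finally show ?thesis .
qed

text \<open>The functional calculus on \<open>c00 \<alpha>\<close>, extended to the completion. The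
  constant is kept explicit so that it can be shared by all orders.\<close>

lemma tau_hom_exists:
  fixes T :: "'a::complex_banach \<Rightarrow>\<^sub>L 'a"
  assumes "\<alpha> > 0" "T \<in> bounded_ops" "\<And>n. norm (cesaro_sum \<alpha> T n) \<le> C * kern (\<alpha> + 1) n"
  shows "\<exists>\<theta>. bounded_alg_hom (tau \<alpha>) \<theta> \<and> \<theta> (tau_unit_seq \<alpha> 1) = T \<and>
    (\<forall>x\<in>alg_carrier (tau \<alpha>). norm (\<theta> x) \<le> C * alg_norm (tau \<alpha>) x)"
proof -
  interpret sequence_algebra "c00 \<alpha>" "2 * exp \<alpha>" by (rule sequence_algebra_c00[OF assms(1)])
  have bound: "norm (power_series_op T f) \<le> C * alg_norm (c00 \<alpha>) f" if "f \<in> alg_carrier (c00 \<alpha>)" for f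
    using norm_power_series_op_le[OF assms(1) _ assms(3)] that by simp
  then have "bounded_alg_hom (c00 \<alpha>) (power_series_op T)"
    unfolding bounded_alg_hom_def
    by (auto simp: power_series_op_bounded_ops power_series_op_add power_series_op_scale
        power_series_op_convolution assms(2) power_summable_finite_support blinfun_apply_scaleC)
  from bounded_alg_hom_extend[OF this bound] obtain \<theta> where
    "bounded_alg_hom (tau \<alpha>) \<theta>" "\<And>f. f \<in> alg_carrier (c00 \<alpha>) \<Longrightarrow> \<theta> (completion_embed (c00 \<alpha>) f) = power_series_op T f"
    "\<And>x. x \<in> alg_carrier (tau \<alpha>) \<Longrightarrow> norm (\<theta> x) \<le> C * alg_norm (tau \<alpha>) x"
    unfolding tau_def by metis
  then show ?thesis
    by (intro exI[of _ \<theta>]) (auto simp: tau_unit_seq_def finite_support_unit_seq power_series_op_unit_seq)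
qed

lemma convolution_unit_seq: "convolution (unit_seq m) (unit_seq n) = unit_seq (m + n)"
proof
  fix k
  have "convolution (unit_seq m) (unit_seq n) k = (\<Sum>j\<in>(if k = m + n then {n} else {}). 1)"
    unfolding convolution_def by (rule sum.mono_neutral_cong_right) (auto simp: unit_seq_def split: if_splits)
  then show "convolution (unit_seq m) (unit_seq n) k = unit_seq (m + n) k"
    by (simp add: unit_seq_def)
qed

text \<open>The index starts at 1 because a homomorphism need not send e_0 to the identity.\<close>

lemma hom_unit_seq:
  assumes "bounded_alg_hom A \<Phi>" "alg_mult A = convolution" "\<And>n. unit_seq n \<in> alg_carrier A"
    and "\<Phi> (unit_seq 1) = T"
  shows "\<Phi> (unit_seq (Suc n)) = op_power T (Suc n)"
proof (induction n)
  case 0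
  then show ?case using assms(4) by simp
next
  case (Suc n)
  have "unit_seq (Suc (Suc n)) = convolution (unit_seq 1) (unit_seq (Suc n))"
    by (simp add: convolution_unit_seq)
  then have "\<Phi> (unit_seq (Suc (Suc n))) = \<Phi> (unit_seq 1) o\<^sub>L \<Phi> (unit_seq (Suc n))"
    using assms(1-3) by (simp add: bounded_alg_hom_def)
  then show ?case unfolding Suc.IH assms(4) by simp
qed

lemma bounded_alg_hom_c00_sum:
  fixes \<Phi> :: "(nat \<Rightarrow> complex) \<Rightarrow> ('a::complex_banach \<Rightarrow>\<^sub>L 'a)"
  assumes \<Phi>: "bounded_alg_hom (c00 \<alpha>) \<Phi>" and "finite I" "\<And>i. i \<in> I \<Longrightarrow> finite {n. h i n \<noteq> 0}"
  shows "\<Phi> (\<lambda>k. \<Sum>i\<in>I. c i * h i k) = (\<Sum>i\<in>I. scaleC (c i) (\<Phi> (h i)))"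
proof -
  have scale: "\<Phi> (\<lambda>k. c * f k) = scaleC c (\<Phi> f)" if "finite {n. f n \<noteq> 0}" for c f
    using bounded_alg_hom_scale[OF \<Phi>, of f c] that by simp
  have add: "\<Phi> (\<lambda>k. f k + g k) = \<Phi> f + \<Phi> g" if "finite {n. f n \<noteq> 0}" "finite {n. g n \<noteq> 0}" for f g
    using \<Phi> that by (auto simp: bounded_alg_hom_def)
  show ?thesis
    using assms(2,3)
  proof (induction I rule: finite_induct)
    case empty
    then show ?case using scale[of "\<lambda>_. 0" 0] by simp
  next
    case (insert i I)
    have "\<Phi> (\<lambda>k. c i * h i k + (\<Sum>i\<in>I. c i * h i k)) = \<Phi> (\<lambda>k. c i * h i k) + \<Phi> (\<lambda>k. \<Sum>i\<in>I. c i * h i k)"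
      using insert by (intro add finite_support_scale finite_support_sum) auto
    then show ?case using insert by (simp add: scale)
  qed
qed

text \<open>Since \<open>\<Phi>\<close> need not be unital, the term \<open>j = 0\<close> of the Cesaro sum is corrected by
  \<open>I - \<Phi>(e\<^sub>0)\<close>, which costs only \<open>k\<^sup>\<alpha>(n) \<le> k\<^sup>\<alpha>\<^sup>+\<^sup>1(n)\<close>.\<close>

lemma cesaro_bounded_if_hom:
  fixes T :: "'a::complex_banach \<Rightarrow>\<^sub>L 'a"
  assumes \<alpha>: "\<alpha> > 0" and \<Phi>: "bounded_alg_hom (c00 \<alpha>) \<Phi>" and T: "\<Phi> (unit_seq 1) = T"
  shows "cesaro_bounded \<alpha> T"
proof -
  obtain C where C: "\<And>f. finite {n. f n \<noteq> 0} \<Longrightarrow> norm (\<Phi> f) \<le> C * q_norm \<alpha> f"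
    using \<Phi> by (auto simp: bounded_alg_hom_def)
  define R where "R = id_blinfun - \<Phi> (unit_seq 0)"
  have "norm (cesaro_sum \<alpha> T n) \<le> (C + norm R) * kern (\<alpha> + 1) n" for n
  proof -
    have "kern_seq \<alpha> n = (\<lambda>k. \<Sum>j\<le>n. of_real (kern \<alpha> (n - j)) * unit_seq j k)"
      by (auto simp: kern_seq_def unit_seq_def if_distrib cong: if_cong)
    then have "\<Phi> (kern_seq \<alpha> n) = (\<Sum>j\<le>n. scaleC (of_real (kern \<alpha> (n - j))) (\<Phi> (unit_seq j)))"
      using bounded_alg_hom_c00_sum[OF \<Phi>, of "{..n}" unit_seq "\<lambda>j. of_real (kern \<alpha> (n - j))"]
      by (simp add: finite_support_unit_seq)
    also have "\<dots> = (\<Sum>j\<le>n. kern \<alpha> (n - j) *\<^sub>R (op_power T j - (if j = 0 then R else 0)))"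
    proof (rule sum.cong[OF refl])
      fix j
      have "\<Phi> (unit_seq j) = op_power T j - (if j = 0 then R else 0)"
      proof (cases j)
        case (Suc i)
        then show ?thesis using hom_unit_seq[OF \<Phi> _ _ T, of i] by (simp add: finite_support_unit_seq)
      qed (simp add: R_def)
      then show "scaleC (of_real (kern \<alpha> (n - j))) (\<Phi> (unit_seq j)) =
          kern \<alpha> (n - j) *\<^sub>R (op_power T j - (if j = 0 then R else 0))"
        by (simp add: scaleC_of_real)
    qed
    also have "\<dots> = cesaro_sum \<alpha> T n - (\<Sum>j\<le>n. kern \<alpha> (n - j) *\<^sub>R (if j = 0 then R else 0))"
      using \<alpha> by (simp add: cesaro_sum_def cesaro_kernel_eq_kern scaleR_diff_right sum_subtractf)
    also have "(\<Sum>j\<le>n. kern \<alpha> (n - j) *\<^sub>R (if j = 0 then R else 0)) =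
        (\<Sum>j\<in>{0}. kern \<alpha> (n - j) *\<^sub>R R)"
      by (rule sum.mono_neutral_cong_right) auto
    finally have "cesaro_sum \<alpha> T n = \<Phi> (kern_seq \<alpha> n) + kern \<alpha> n *\<^sub>R R" by simp
    then have "norm (cesaro_sum \<alpha> T n) \<le> norm (\<Phi> (kern_seq \<alpha> n)) + kern \<alpha> n * norm R"
      using norm_triangle_ineq[of "\<Phi> (kern_seq \<alpha> n)" "kern \<alpha> n *\<^sub>R R"] \<alpha> by (simp add: kern_nonneg)
    also have "norm (\<Phi> (kern_seq \<alpha> n)) \<le> C * kern (\<alpha> + 1) n"
      using C[OF finite_support_kern_seq[of \<alpha> n]] by (simp add: q_norm_kern_seq \<alpha>)
    \<comment> \<open>\<open>kern \<alpha> n\<close> is one of the nonnegative terms whose sum is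
      \<open>kern (\<alpha> + 1) n\<close>.\<close>
    also have "kern \<alpha> n * norm R \<le> kern (\<alpha> + 1) n * norm R"
      unfolding sum_kern[symmetric]
      using \<alpha> by (intro mult_right_mono member_le_sum) (auto simp: kern_nonneg)
    finally show ?thesis by (simp add: algebra_simps)
  qed
  then have "1 / cesaro_kernel (\<alpha> + 1) n * norm (cesaro_sum \<alpha> T n) \<le> C + norm R" for n
    using \<alpha> kern_pos[of "\<alpha> + 1" n] by (simp add: cesaro_kernel_eq_kern divide_simps mult.commute)
  then show ?thesis unfolding cesaro_bounded_def by (intro bdd_aboveI2)
qed

lemma cesaro_boundedE:
  assumes "\<alpha> > 0" "cesaro_bounded \<alpha> T"
  obtains C where "\<And>n. norm (cesaro_sum \<alpha> T n) \<le> C * kern (\<alpha> + 1) n"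
proof -
  obtain C where C: "1 / cesaro_kernel (\<alpha> + 1) n * norm (cesaro_sum \<alpha> T n) \<le> C" for n
    using assms(2) unfolding cesaro_bounded_def bdd_above_def by blast
  have "norm (cesaro_sum \<alpha> T n) \<le> C * kern (\<alpha> + 1) n" for n
    using C[of n] assms(1) kern_pos[of "\<alpha> + 1" n] by (simp add: cesaro_kernel_eq_kern divide_simps)
  then show thesis by (rule that)
qed

lemma cesaro_bounded_iff_hom:
  fixes T :: "'a::complex_banach \<Rightarrow>\<^sub>L 'a"
  assumes "\<alpha> > 0" "T \<in> bounded_ops"
  shows "cesaro_bounded \<alpha> T \<longleftrightarrow> (\<exists>\<theta>. bounded_alg_hom (tau \<alpha>) \<theta> \<and> \<theta> (tau_unit_seq \<alpha> 1) = T)"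
proof
  assume "cesaro_bounded \<alpha> T"
  then obtain C where C: "\<And>n. norm (cesaro_sum \<alpha> T n) \<le> C * kern (\<alpha> + 1) n"
    using cesaro_boundedE[OF assms(1)] by blast
  from tau_hom_exists[OF assms C]
  show "\<exists>\<theta>. bounded_alg_hom (tau \<alpha>) \<theta> \<and> \<theta> (tau_unit_seq \<alpha> 1) = T" by blast
next
  interpret sequence_algebra "c00 \<alpha>" "2 * exp \<alpha>" by (rule sequence_algebra_c00[OF assms(1)])
  assume "\<exists>\<theta>. bounded_alg_hom (tau \<alpha>) \<theta> \<and> \<theta> (tau_unit_seq \<alpha> 1) = T"
  then show "cesaro_bounded \<alpha> T"
    using cesaro_bounded_if_hom[OF assms(1) bounded_alg_hom_restrict] by (auto simp: tau_def tau_unit_seq_def)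
qed

section \<open>Power boundedness and homomorphisms on l^1\<close>

lemma power_bounded_iff: "power_bounded T \<longleftrightarrow> (\<exists>M. \<forall>n. norm (op_power T n) \<le> M)"
  by (auto simp: power_bounded_def bdd_above_def)

text \<open>Homomorphisms control only positive powers; the zeroth is a single operator and is
  absorbed by a maximum.\<close>

lemma power_bounded_if_Suc:
  assumes "\<And>n. norm (op_power T (Suc n)) \<le> M"
  shows "power_bounded T"
proof -
  have "norm (op_power T n) \<le> max M (norm (op_power T 0))" for n
    using assms by (cases n) (auto simp: le_max_iff_disj)
  then show ?thesis by (auto simp: power_bounded_iff)
qed

lemma summable_unit_seq: "summable (\<lambda>k. cmod (unit_seq n k))"
  by (rule summable_finite[of "{n}"]) (auto simp: unit_seq_def)

lemma norm_ell1_unit_seq: "(\<Sum>k. cmod (unit_seq n k)) = 1"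
  by (subst suminf_finite[of "{n}"]) (auto simp: unit_seq_def)

text \<open>Bounded powers make the series converge absolutely with norm at most M times the l^1
  norm. Conversely every e_n has l^1 norm 1, so the bound on the homomorphism bounds all positive
  powers.\<close>

lemma power_bounded_iff_ell1_hom:
  fixes T :: "'a::complex_banach \<Rightarrow>\<^sub>L 'a"
  assumes T: "T \<in> bounded_ops"
  shows "power_bounded T \<longleftrightarrow> (\<exists>\<theta>. bounded_alg_hom ell1 \<theta> \<and> \<theta> (unit_seq 1) = T)"
proof
  assume "power_bounded T"
  then obtain M where M: "\<And>n. norm (op_power T n) \<le> M" by (auto simp: power_bounded_iff)
  have le: "norm (scaleC (f n) (op_power T n)) \<le> M * cmod (f n)" for f n
    using mult_left_mono[OF M[of n], of "cmod (f n)"] by (simp add: norm_scaleC mult.commute)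
  have sum: "power_summable T f" if "summable (\<lambda>n. cmod (f n))" for f
  proof -
    have "summable (\<lambda>n. norm (scaleC (f n) (op_power T n)))"
      by (rule summable_comparison_test'[OF summable_mult[OF that, of M]]) (use le in auto)
    then show ?thesis by (subst summable_on_UNIV_nonneg_real_iff) auto
  qed
  have "norm (power_series_op T f) \<le> M * (\<Sum>n. cmod (f n))" if f: "summable (\<lambda>n. cmod (f n))" for f
  proof -
    have "(\<lambda>n. scaleC (f n) (op_power T n)) sums power_series_op T f"
      unfolding power_series_op_def
      by (rule has_sum_imp_sums[OF has_sum_infsum[OF abs_summable_summable[OF sum[OF f]]]])
    then have "norm (power_series_op T f) = norm (\<Sum>n. scaleC (f n) (op_power T n))"
      by (simp add: sums_iff)
    also have s: "summable (\<lambda>n. norm (scaleC (f n) (op_power T n)))"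
      using sum[OF f] by (subst (asm) summable_on_UNIV_nonneg_real_iff) auto
    then have "norm (\<Sum>n. scaleC (f n) (op_power T n)) \<le> (\<Sum>n. norm (scaleC (f n) (op_power T n)))"
      by (rule summable_norm)
    also have "\<dots> \<le> (\<Sum>n. M * cmod (f n))"
      by (intro suminf_le le s summable_mult f)
    also have "\<dots> = M * (\<Sum>n. cmod (f n))" by (rule suminf_mult[OF f])
    finally show ?thesis .
  qed
  then have "bounded_alg_hom ell1 (power_series_op T)"
    unfolding bounded_alg_hom_def
    by (auto simp: power_series_op_bounded_ops power_series_op_add power_series_op_scale
        power_series_op_convolution T sum blinfun_apply_scaleC)
  moreover have "power_series_op T (unit_seq 1) = T"
    by (simp add: power_series_op_unit_seq)
  ultimately show "\<exists>\<theta>. bounded_alg_hom ell1 \<theta> \<and> \<theta> (unit_seq 1) = T" by blast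
next
  assume "\<exists>\<theta>. bounded_alg_hom ell1 \<theta> \<and> \<theta> (unit_seq 1) = T"
  then obtain \<theta> where \<theta>: "bounded_alg_hom ell1 \<theta>" "\<theta> (unit_seq 1) = T" by blast
  obtain C where C: "\<And>f. summable (\<lambda>n. cmod (f n)) \<Longrightarrow> norm (\<theta> f) \<le> C * (\<Sum>n. cmod (f n))"
    using \<theta>(1) by (auto simp: bounded_alg_hom_def)
  have "norm (op_power T (Suc n)) \<le> C" for n
    using C[OF summable_unit_seq[of "Suc n"]] hom_unit_seq[OF \<theta>(1) _ _ \<theta>(2), of n]
    by (simp add: summable_unit_seq norm_ell1_unit_seq del: op_power.simps)
  then show "power_bounded T" by (rule power_bounded_if_Suc)
qed

section \<open>Orders between 0 and 1 and the limit at order 0\<close>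

lemma norm_cesaro_sum_le:
  assumes "\<alpha> > 0" "\<And>n. norm (op_power T n) \<le> M"
  shows "norm (cesaro_sum \<alpha> T n) \<le> M * kern (\<alpha> + 1) n"
proof -
  have "norm (cesaro_sum \<alpha> T n) \<le> (\<Sum>j\<le>n. kern \<alpha> (n - j) * M)"
    unfolding cesaro_sum_def using assms
    by (intro sum_norm_le) (auto simp: cesaro_kernel_eq_kern kern_nonneg intro!: mult_left_mono)
  also have "\<dots> = M * (\<Sum>i\<le>n. kern \<alpha> i)"
    unfolding sum_distrib_left
    by (rule sum.reindex_bij_witness[of _ "\<lambda>i. n - i" "\<lambda>j. n - j"]) auto
  finally show ?thesis by (simp add: sum_kern)
qed

text \<open>Uniformity in \<alpha> is stated for \<open>hom_norm\<close>, so the estimate must hold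
  with this constant rather than with some bound. Scaling \<open>f\<close> to norm 1 achieves
  this.\<close>

lemma norm_le_hom_norm:
  fixes \<theta> :: "(nat \<Rightarrow> nat \<Rightarrow> complex) set \<Rightarrow> ('a::complex_banach \<Rightarrow>\<^sub>L 'a)"
  assumes \<alpha>: "\<alpha> > 0" and \<theta>: "bounded_alg_hom (tau \<alpha>) \<theta>" and f: "finite {n. f n \<noteq> 0}"
  shows "norm (\<theta> (completion_embed (c00 \<alpha>) f)) \<le> hom_norm (tau \<alpha>) \<theta> * q_norm \<alpha> f"
proof -
  interpret sequence_algebra "c00 \<alpha>" "2 * exp \<alpha>" by (rule sequence_algebra_c00[OF \<alpha>])
  let ?e = "completion_embed (c00 \<alpha>)"
  have \<Phi>: "bounded_alg_hom (c00 \<alpha>) (\<lambda>f. \<theta> (?e f))"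
    using bounded_alg_hom_restrict \<theta> by (simp add: tau_def)
  obtain C where C: "\<And>x. x \<in> alg_carrier (tau \<alpha>) \<Longrightarrow> norm (\<theta> x) \<le> C * alg_norm (tau \<alpha>) x"
    using \<theta> unfolding bounded_alg_hom_def by blast
  have nonneg: "alg_norm (tau \<alpha>) x \<ge> 0" if "x \<in> alg_carrier (tau \<alpha>)" for x
  proof -
    obtain F where F: "F \<in> alg_cauchy (c00 \<alpha>)" "x = cauchy_class (c00 \<alpha>) F"
      using \<open>x \<in> _\<close> by (auto simp: tau_def completion_carrier)
    show ?thesis
      using tendsto_lowerbound[OF completion_norm_tendsto[OF F(1)], of 0] norm_nonneg[OF cauchy_carrier[OF F(1)]]
      by (simp add: F(2) tau_def)
  qed
  have emb: "?e g \<in> alg_carrier (tau \<alpha>)" "alg_norm (tau \<alpha>) (?e g) = q_norm \<alpha> g" if "finite {n. g n \<noteq> 0}" for g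
    using embed_closed[of g] completion_norm_embed[of g] that by (simp_all add: tau_def)
  define r where "r = q_norm \<alpha> f"
  show ?thesis
  \<comment> \<open>If q(f) = 0, boundedness forces the image to vanish, and no scaling is
    required.\<close>
  proof (cases "r = 0")
    case True
    then show ?thesis using C[OF emb(1)[OF f]] emb(2)[OF f] by (simp add: r_def)
  next
    case False
    then have "r > 0" using q_norm_nonneg[OF \<alpha> f] by (simp add: r_def)
    define g where "g = (\<lambda>n. of_real (1 / r) * f n)"
    have g: "finite {n. g n \<noteq> 0}" unfolding g_def by (rule finite_support_scale[OF f])
    have qg: "q_norm \<alpha> g = 1"
      unfolding g_def q_norm_scale[OF \<alpha> f] r_def[symmetric] using \<open>r > 0\<close> by (simp add: norm_divide)
    \<comment> \<open>A real supremum dominates its members only once the set is known to be bounded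
      above.\<close>
    have bdd: "bdd_above ((\<lambda>x. norm (\<theta> x)) ` {x \<in> alg_carrier (tau \<alpha>). alg_norm (tau \<alpha>) x \<le> 1})"
    proof (rule bdd_aboveI2)
      fix x assume "x \<in> {x \<in> alg_carrier (tau \<alpha>). alg_norm (tau \<alpha>) x \<le> 1}"
      then have x: "x \<in> alg_carrier (tau \<alpha>)" "alg_norm (tau \<alpha>) x \<le> 1" by auto
      have "norm (\<theta> x) \<le> C * alg_norm (tau \<alpha>) x" by (rule C[OF x(1)])
      also have "\<dots> \<le> \<bar>C\<bar> * 1" using x(2) nonneg[OF x(1)] by (intro mult_mono) auto
      finally show "norm (\<theta> x) \<le> \<bar>C\<bar>" by simp
    qed
    have "norm (\<theta> (?e g)) \<le> hom_norm (tau \<alpha>) \<theta>"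
      unfolding hom_norm_def by (rule cSUP_upper[OF _ bdd]) (use emb[OF g] qg in auto)
    moreover have "\<theta> (?e g) = scaleC (of_real (1 / r)) (\<theta> (?e f))"
      unfolding g_def using bounded_alg_hom_scale[OF \<Phi>, of f "of_real (1 / r)"] f by simp
    then have "norm (\<theta> (?e g)) = norm (\<theta> (?e f)) / r"
      using \<open>r > 0\<close> by (simp add: norm_scaleC norm_divide)
    ultimately show ?thesis using \<open>r > 0\<close> by (simp add: r_def[symmetric] divide_simps)
  qed
qed

text \<open>For fixed n the norm is a finite sum continuous in \<alpha>, since \<open>kern\<close>
  is polynomial in its order. At order 0 the factor \<open>kern 0 (n - j)\<close> leaves only j = n,
  with value 1.\<close>

lemma q_norm_unit_seq_tendsto: "((\<lambda>\<alpha>. q_norm \<alpha> (unit_seq n)) \<longlongrightarrow> 1) (at_right 0)"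
proof -
  have cont: "continuous_on UNIV (\<lambda>a. kern (f a) k)" if "continuous_on UNIV f" for f :: "real \<Rightarrow> real" and k
    unfolding kern_def by (intro continuous_intros that) auto
  have kt: "((\<lambda>a. kern (f a) k) \<longlongrightarrow> kern (f 0) k) (at_right 0)" if "continuous_on UNIV f" for f :: "real \<Rightarrow> real" and k
    using cont[OF that, of k] by (auto simp: continuous_on_def intro: tendsto_within_subset)
  have "((\<lambda>\<alpha>. \<Sum>j\<le>n. kern (\<alpha> + 1) j * \<bar>kern (- \<alpha>) (n - j)\<bar>) \<longlongrightarrow> (\<Sum>j\<le>n. kern (0 + 1) j * \<bar>kern (- 0) (n - j)\<bar>)) (at_right 0)"
    by (intro tendsto_intros kt[of "\<lambda>a. a + 1"] kt[of "\<lambda>a. - a"] continuous_intros)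
  also have "(\<Sum>j\<le>n. kern (0 + 1) j * \<bar>kern (- 0) (n - j)\<bar>) = (\<Sum>j\<in>{n}. 1)"
    by (rule sum.mono_neutral_cong_right) (auto simp: kern_0_left)
  finally have "((\<lambda>\<alpha>. \<Sum>j\<le>n. kern (\<alpha> + 1) j * \<bar>kern (- \<alpha>) (n - j)\<bar>) \<longlongrightarrow> 1) (at_right 0)" by simp
  moreover have "(\<Sum>j\<le>n. kern (\<alpha> + 1) j * \<bar>kern (- \<alpha>) (n - j)\<bar>) = q_norm \<alpha> (unit_seq n)" if "\<alpha> > 0" for \<alpha>
  proof -
    have "q_norm \<alpha> (unit_seq n) = (\<Sum>j\<le>n. kern (\<alpha> + 1) j * cmod (weyl (- \<alpha>) (unit_seq n) j))"
      using that by (intro q_norm_eq_sum) (auto simp: unit_seq_def)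
    then show ?thesis by (simp add: weyl_unit_seq kern_seq_def)
  qed
  ultimately show ?thesis
    by (elim Lim_transform_eventually) (auto intro: eventually_mono[OF eventually_at_right_less])
qed

text \<open>A bound M on the powers bounds every Cesaro sum with the same M for all orders.
  Conversely, for fixed n, T^(n+1) is bounded by B q(e_(n+1)) at every order in (0, 1), and the
  right side tends to B as the order tends to 0.\<close>

lemma power_bounded_iff_tau_homs:
  fixes T :: "'a::complex_banach \<Rightarrow>\<^sub>L 'a"
  assumes T: "T \<in> bounded_ops"
  shows "power_bounded T \<longleftrightarrow>
    (\<exists>\<theta>. (\<forall>\<alpha>\<in>{0<..<1}. bounded_alg_hom (tau \<alpha>) (\<theta> \<alpha>) \<and> \<theta> \<alpha> (tau_unit_seq \<alpha> 1) = T) \<and>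
      bdd_above ((\<lambda>\<alpha>. hom_norm (tau \<alpha>) (\<theta> \<alpha>)) ` {0<..<1}))"
proof
  assume "power_bounded T"
  then obtain M where M: "\<And>n. norm (op_power T n) \<le> M" by (auto simp: power_bounded_iff)
  then have "M \<ge> 0" using norm_ge_zero order_trans by blast
  have "\<forall>\<alpha>\<in>{0<..<1}. \<exists>\<theta>. bounded_alg_hom (tau \<alpha>) \<theta> \<and> \<theta> (tau_unit_seq \<alpha> 1) = T \<and>
    (\<forall>x\<in>alg_carrier (tau \<alpha>). norm (\<theta> x) \<le> M * alg_norm (tau \<alpha>) x)"
    using tau_hom_exists[OF _ T norm_cesaro_sum_le[OF _ M]] by auto
  then obtain \<theta> where \<theta>: "\<And>\<alpha>. \<alpha> \<in> {0<..<1} \<Longrightarrow> bounded_alg_hom (tau \<alpha>) (\<theta> \<alpha>) \<and> \<theta> \<alpha> (tau_unit_seq \<alpha> 1) = T \<and>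
    (\<forall>x\<in>alg_carrier (tau \<alpha>). norm (\<theta> \<alpha> x) \<le> M * alg_norm (tau \<alpha>) x)"
    by metis
  have "hom_norm (tau \<alpha>) (\<theta> \<alpha>) \<le> M" if \<alpha>: "\<alpha> \<in> {0<..<1}" for \<alpha>
  proof -
    interpret sequence_algebra "c00 \<alpha>" "2 * exp \<alpha>" using \<alpha> by (intro sequence_algebra_c00) auto
    \<comment> \<open>The zero element makes the unit ball nonempty, as bounding the supremum from
      above requires.\<close>
    have "q_norm \<alpha> (\<lambda>_. 0) = 0" using q_norm_scale[of \<alpha> "\<lambda>_. 0" 0] \<alpha> by simp
    then have "completion_embed (c00 \<alpha>) (\<lambda>_. 0) \<in> {x \<in> alg_carrier (tau \<alpha>). alg_norm (tau \<alpha>) x \<le> 1}"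
      using embed_closed[of "\<lambda>_. 0"] completion_norm_embed[of "\<lambda>_. 0"] by (simp add: tau_def)
    moreover have "norm (\<theta> \<alpha> x) \<le> M" if "x \<in> alg_carrier (tau \<alpha>)" "alg_norm (tau \<alpha>) x \<le> 1" for x
    proof -
      have "norm (\<theta> \<alpha> x) \<le> M * alg_norm (tau \<alpha>) x" using \<theta>[OF \<alpha>] that by blast
      also have "\<dots> \<le> M * 1" using that \<open>M \<ge> 0\<close> by (intro mult_left_mono)
      finally show ?thesis by simp
    qed
    ultimately show ?thesis unfolding hom_norm_def by (intro cSUP_least) auto
  qed
  then have "bdd_above ((\<lambda>\<alpha>. hom_norm (tau \<alpha>) (\<theta> \<alpha>)) ` {0<..<1})" by (intro bdd_aboveI2)
  with \<theta> show "\<exists>\<theta>. (\<forall>\<alpha>\<in>{0<..<1}. bounded_alg_hom (tau \<alpha>) (\<theta> \<alpha>) \<and> \<theta> \<alpha> (tau_unit_seq \<alpha> 1) = T) \<and>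
      bdd_above ((\<lambda>\<alpha>. hom_norm (tau \<alpha>) (\<theta> \<alpha>)) ` {0<..<1})"
    by blast
next
  assume "\<exists>\<theta>. (\<forall>\<alpha>\<in>{0<..<1}. bounded_alg_hom (tau \<alpha>) (\<theta> \<alpha>) \<and> \<theta> \<alpha> (tau_unit_seq \<alpha> 1) = T) \<and>
      bdd_above ((\<lambda>\<alpha>. hom_norm (tau \<alpha>) (\<theta> \<alpha>)) ` {0<..<1})"
  then obtain \<theta> B where \<theta>: "\<And>\<alpha>. \<alpha> \<in> {0<..<1} \<Longrightarrow> bounded_alg_hom (tau \<alpha>) (\<theta> \<alpha>)"
      "\<And>\<alpha>. \<alpha> \<in> {0<..<1} \<Longrightarrow> \<theta> \<alpha> (tau_unit_seq \<alpha> 1) = T"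
    and B: "\<And>\<alpha>. \<alpha> \<in> {0<..<1} \<Longrightarrow> hom_norm (tau \<alpha>) (\<theta> \<alpha>) \<le> B"
    unfolding bdd_above_def by blast
  have "norm (op_power T (Suc n)) \<le> B" for n
  proof -
    have le: "norm (op_power T (Suc n)) \<le> B * q_norm \<alpha> (unit_seq (Suc n))" if \<alpha>: "\<alpha> \<in> {0<..<1}" for \<alpha>
    proof -
      interpret sequence_algebra "c00 \<alpha>" "2 * exp \<alpha>" using \<alpha> by (intro sequence_algebra_c00) auto
      have \<Phi>: "bounded_alg_hom (c00 \<alpha>) (\<lambda>f. \<theta> \<alpha> (completion_embed (c00 \<alpha>) f))"
        using bounded_alg_hom_restrict \<theta>(1)[OF \<alpha>] by (simp add: tau_def)
      have "op_power T (Suc n) = \<theta> \<alpha> (completion_embed (c00 \<alpha>) (unit_seq (Suc n)))"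
        using hom_unit_seq[OF \<Phi>, of T n] \<theta>(2)[OF \<alpha>] by (simp add: tau_unit_seq_def finite_support_unit_seq)
      then have "norm (op_power T (Suc n)) \<le> hom_norm (tau \<alpha>) (\<theta> \<alpha>) * q_norm \<alpha> (unit_seq (Suc n))"
        using norm_le_hom_norm[OF _ \<theta>(1)[OF \<alpha>] finite_support_unit_seq[of "Suc n"]] \<alpha> by simp
      also have "\<dots> \<le> B * q_norm \<alpha> (unit_seq (Suc n))"
        using \<alpha> by (intro mult_right_mono B q_norm_nonneg finite_support_unit_seq) auto
      finally show ?thesis .
    qed
    have "((\<lambda>\<alpha>. B * q_norm \<alpha> (unit_seq (Suc n))) \<longlongrightarrow> B * 1) (at_right 0)"
      by (intro tendsto_intros q_norm_unit_seq_tendsto)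
    moreover have "\<forall>\<^sub>F \<alpha> in at_right 0. norm (op_power T (Suc n)) \<le> B * q_norm \<alpha> (unit_seq (Suc n))"
      using le by (auto simp: eventually_at_right_field intro!: exI[of _ 1])
    ultimately show ?thesis
      using tendsto_lowerbound[of _ "B * 1" "at_right 0"] by fastforce
  qed
  then show "power_bounded T" by (rule power_bounded_if_Suc)
qed

theorem corollary7:
  fixes T :: "'a::complex_banach \<Rightarrow>\<^sub>L 'a"
  assumes "T \<in> bounded_ops"
  shows "(\<forall>\<alpha>>0.
            cesaro_bounded \<alpha> T \<longleftrightarrow>
            (\<exists>\<theta> :: (nat \<Rightarrow> nat \<Rightarrow> complex) set \<Rightarrow> ('a \<Rightarrow>\<^sub>L 'a).
               bounded_alg_hom (tau \<alpha>) \<theta> \<and> \<theta> (tau_unit_seq \<alpha> 1) = T)) \<and>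
         (power_bounded T \<longleftrightarrow>
            (\<exists>\<theta> :: (nat \<Rightarrow> complex) \<Rightarrow> ('a \<Rightarrow>\<^sub>L 'a).
               bounded_alg_hom ell1 \<theta> \<and> \<theta> (unit_seq 1) = T)) \<and>
         (power_bounded T \<longleftrightarrow>
            (\<exists>\<theta> :: real \<Rightarrow> (nat \<Rightarrow> nat \<Rightarrow> complex) set \<Rightarrow> ('a \<Rightarrow>\<^sub>L 'a).
               (\<forall>\<alpha>\<in>{0<..<1}. bounded_alg_hom (tau \<alpha>) (\<theta> \<alpha>) \<and> \<theta> \<alpha> (tau_unit_seq \<alpha> 1) = T) \<and>
               bdd_above ((\<lambda>\<alpha>. hom_norm (tau \<alpha>) (\<theta> \<alpha>)) ` {0<..<1})))"
  by (intro conjI allI impI cesaro_bounded_iff_hom power_bounded_iff_ell1_hom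
      power_bounded_iff_tau_homs assms)

end
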